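(* Let $A$ be a graded superring, $B$ a graded subring, $\alpha$ an automorphism of $A$, $\beta$ an automorphism of $B$, $\lambda\in\Lambda$, $\pi\in\mathbb{Z}_2$. Assume that $A$ is finitely generated and projective as a left $B$-module. Then $A$ is an $(\alpha,\beta)$-Frobenius extension of $B$ of degree $(-\lambda,\pi)$ if and only if there exists a homomorphism of $(B,B)$-bimodules $\mathrm{tr}^{\mathrm L}\colon{}^{\beta}_{B}A^{\alpha}_{B}\to\{\lambda,\pi\}{}_BB_B$ satisfying: (L3) if $\mathrm{tr}^{\mathrm L}(Aa)=0$ for some $a\in A$, then $a=0$; (L4) for every $\varphi\in\mathrm{HOM}^{\mathrm L}_B({}^{\beta}_{B}A,\{\lambda,\pi\}{}_BB)$ there exists an $a\in A$ such that $\varphi=\mathrm{tr}^{\mathrm L}\circ{}^{r}a$.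
   Context: Fix an abelian group $\Lambda$. A graded superring is an associative unital $\Lambda\times\mathbb{Z}_2$-graded ring; subrings are graded (with the same unit), automorphisms preserve the grading, and modules and bimodules are $\Lambda\times\mathbb{Z}_2$-graded. For homogeneous $v$, $|v|\in\Lambda$ and $\bar v\in\mathbb{Z}_2$ denote its degrees; formulas involving degrees are stated for homogeneous elements and extended additively. Homomorphisms of modules and bimodules are additive maps of degree $(0,0)$ commuting strictly with the actions. Shifts: $\{\mu,\gamma\}M$ is $M$ as an abelian group, with $(\{\mu,\gamma\}M)_{\nu,\delta}=M_{\nu-\mu,\delta+\gamma}$, unchanged right action, and left action $a\cdot\{\mu,\gamma\}m=(-1)^{\gamma\bar a}\{\mu,\gamma\}(am)$. Twists: ${}^{\beta}_{B}A^{\alpha}_{A}$ is $A$ as a graded abelian group with $b\cdot x=\beta(b)x$ ($b\in B$) and $x\cdot a=x\alpha(a)$ ($a\in A$); ${}^{\beta}_{B}A^{\alpha}_{B}$ and ${}^{\beta}_{B}A$ are obtained by restricting, resp. forgetting, the right action. For $a\in A$, ${}^{r}a\colon A\to A$ is ${}^{r}a(x)=(-1)^{\bar a\bar x}xa$ (ordinary multiplication in $A$). $\mathrm{HOM}^{\mathrm L}_B({}^{\beta}_{B}A,\{\lambda,\pi\}{}_BB)$ is the direct sum over $(\mu,\gamma)\in\Lambda\times\mathbb{Z}_2$ of the groups of additive maps $f\colon A\to\{\lambda,\pi\}B$ of degree $(\mu,\gamma)$ with $f(\beta(b)x)=(-1)^{\gamma\bar b}\,b\cdot f(x)$ (action in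 $\{\lambda,\pi\}B$). The same group, denoted $\mathrm{HOM}^{\mathrm L}_B({}^{\beta}_{B}A^{\alpha}_{A},\{\lambda,\pi\}{}_BB_B)$, is an $(A,B)$-bimodule via $(a\cdot f)(x)=(-1)^{\bar a\bar f+\bar a\bar x}f(x\alpha(a))$ and $(f\cdot b)(x)=(-1)^{\bar b\bar x}f(x)b$. $A$ is an $(\alpha,\beta)$-Frobenius extension of $B$ of degree $(-\lambda,\pi)$ if (L1) $A$ is finitely generated and projective as a left $B$-module, and (L2) ${}_AA_B\cong\mathrm{HOM}^{\mathrm L}_B({}^{\beta}_{B}A^{\alpha}_{A},\{\lambda,\pi\}{}_BB_B)$ as $(A,B)$-bimodules. *)

theory Defs
  imports Main "HOL-Library.Z2" "HOL-Library.Product_Plus" "HOL-Library.Function_Algebras"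
begin

section \<open>Graded abelian groups\<close>

text \<open>
  A graded group is given by its family of homogeneous parts, which are subgroups of one ambient
  abelian group; the graded group itself is their internal direct sum \<open>dsum G\<close>.
  The group \<open>\<Lambda>\<close> is a type \<open>'l\<close> of class ab_group_add and degrees are pairs in \<open>'l \<times> bit\<close>.
\<close>

definition decomposes :: "('d \<Rightarrow> 'm::ab_group_add set) \<Rightarrow> 'm \<Rightarrow> ('d \<Rightarrow> 'm) \<Rightarrow> bool" where
  "decomposes G x c \<longleftrightarrow>
     (\<forall>d. c d \<in> G d) \<and> finite {d. c d \<noteq> 0} \<and> x = (\<Sum>d | c d \<noteq> 0. c d)"

definition dsum :: "('d \<Rightarrow> 'm::ab_group_add set) \<Rightarrow> 'm set" where
  "dsum G = {x. \<exists>c. decomposes G x c}"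

definition is_grading :: "('d \<Rightarrow> 'm::ab_group_add set) \<Rightarrow> bool" where
  "is_grading G \<longleftrightarrow>
     (\<forall>d. 0 \<in> G d \<and> (\<forall>x\<in>G d. \<forall>y\<in>G d. x - y \<in> G d)) \<and>
     (\<forall>x c c'. decomposes G x c \<longrightarrow> decomposes G x c' \<longrightarrow> c = c')"

definition hcomp :: "('d \<Rightarrow> 'm::ab_group_add set) \<Rightarrow> 'd \<Rightarrow> 'm \<Rightarrow> 'm" where
  "hcomp G d x = (if x \<in> dsum G then (THE c. decomposes G x c) d else 0)"

text \<open>
  Additive extension of a formula that is given for homogeneous elements:
  \<open>F d y\<close> is its value at a homogeneous \<open>y\<close> of degree \<open>d\<close>.
\<close>

definition hsum ::
  "('d \<Rightarrow> 'm::ab_group_add set) \<Rightarrow> 'm \<Rightarrow> ('d \<Rightarrow> 'm \<Rightarrow> 'n::comm_monoid_add) \<Rightarrow> 'n" where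
  "hsum G x F = (\<Sum>d | hcomp G d x \<noteq> 0. F d (hcomp G d x))"

text \<open>\<open>neg_pow \<gamma> x\<close> is \<open>(-1)\<^sup>\<gamma> x\<close>.\<close>

definition neg_pow :: "bit \<Rightarrow> 'm::ab_group_add \<Rightarrow> 'm" where
  "neg_pow \<gamma> x = (if \<gamma> = 0 then x else - x)"


section \<open>Graded superrings\<close>

text \<open>
  The ambient sort \<open>{ring, monoid_mult}\<close> is that of associative unital rings; unlike ring_1 it
  does not exclude the zero ring.
\<close>

type_synonym ('l, 'a) ring_grading = "'l \<times> bit \<Rightarrow> 'a set"

definition graded_superring ::
  "('l::ab_group_add, 'a::{ring, monoid_mult}) ring_grading \<Rightarrow> bool" where
  "graded_superring R \<longleftrightarrow>
     is_grading R \<and> 1 \<in> R 0 \<and> (\<forall>d e. \<forall>a\<in>R d. \<forall>b\<in>R e. a * b \<in> R (d + e))"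

text \<open>It follows that \<open>B d = dsum B \<inter> A d\<close>.\<close>

definition graded_subring ::
  "('l::ab_group_add, 'a::{ring, monoid_mult}) ring_grading \<Rightarrow> ('l, 'a) ring_grading \<Rightarrow> bool" where
  "graded_subring B A \<longleftrightarrow> graded_superring B \<and> (\<forall>d. B d \<subseteq> A d)"

definition graded_automorphism ::
  "('l::ab_group_add, 'a::{ring, monoid_mult}) ring_grading \<Rightarrow> ('a \<Rightarrow> 'a) \<Rightarrow> bool" where
  "graded_automorphism R \<sigma> \<longleftrightarrow>
     bij_betw \<sigma> (dsum R) (dsum R) \<and> \<sigma> 1 = 1 \<and>
     (\<forall>x\<in>dsum R. \<forall>y\<in>dsum R. \<sigma> (x + y) = \<sigma> x + \<sigma> y \<and> \<sigma> (x * y) = \<sigma> x * \<sigma> y) \<and>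
     (\<forall>d. \<sigma> ` R d = R d)"


section \<open>Graded modules and bimodules\<close>

text \<open>
  The coefficient rings are not part of the records; only the action of elements of \<open>dsum R\<close>
  is relevant when a module is regarded over \<open>R\<close>. Thus restriction of scalars is implicit, and
  a bimodule record is also accepted where a left module is expected.
\<close>

record ('l, 'a, 'm) gmodule =
  gr :: "'l \<times> bit \<Rightarrow> 'm set"
  lact :: "'a \<Rightarrow> 'm \<Rightarrow> 'm"

record ('l, 'a, 'm) gbimodule = "('l, 'a, 'm) gmodule" +
  ract :: "'m \<Rightarrow> 'a \<Rightarrow> 'm"

definition left_gmodule ::
  "('l::ab_group_add, 'a::{ring, monoid_mult}) ring_grading \<Rightarrow>
   ('l, 'a, 'm::ab_group_add, 'z) gmodule_scheme \<Rightarrow> bool" where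
  "left_gmodule R M \<longleftrightarrow>
     is_grading (gr M) \<and>
     (\<forall>d e. \<forall>r\<in>R d. \<forall>x\<in>gr M e. lact M r x \<in> gr M (d + e)) \<and>
     (\<forall>r\<in>dsum R. \<forall>s\<in>dsum R. \<forall>x\<in>dsum (gr M). \<forall>y\<in>dsum (gr M).
        lact M r (x + y) = lact M r x + lact M r y \<and>
        lact M (r + s) x = lact M r x + lact M s x \<and>
        lact M (r * s) x = lact M r (lact M s x) \<and>
        lact M 1 x = x)"

definition left_hom ::
  "('l::ab_group_add, 'a::{ring, monoid_mult}) ring_grading \<Rightarrow>
   ('l, 'a, 'm::ab_group_add, 'y) gmodule_scheme \<Rightarrow>
   ('l, 'a, 'n::ab_group_add, 'z) gmodule_scheme \<Rightarrow> ('m \<Rightarrow> 'n) \<Rightarrow> bool" where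
  "left_hom R M N f \<longleftrightarrow>
     (\<forall>x\<in>dsum (gr M). \<forall>y\<in>dsum (gr M). f (x + y) = f x + f y) \<and>
     (\<forall>d. f ` gr M d \<subseteq> gr N d) \<and>
     (\<forall>r\<in>dsum R. \<forall>x\<in>dsum (gr M). f (lact M r x) = lact N r (f x))"

definition bimodule_hom ::
  "('l::ab_group_add, 'a::{ring, monoid_mult}) ring_grading \<Rightarrow> ('l, 'a) ring_grading \<Rightarrow>
   ('l, 'a, 'm::ab_group_add) gbimodule \<Rightarrow> ('l, 'a, 'n::ab_group_add) gbimodule \<Rightarrow>
   ('m \<Rightarrow> 'n) \<Rightarrow> bool" where
  "bimodule_hom R S M N f \<longleftrightarrow>
     left_hom R M N f \<and>
     (\<forall>s\<in>dsum S. \<forall>x\<in>dsum (gr M). f (ract M x s) = ract N (f x) s)"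

definition bimodule_isomorphic ::
  "('l::ab_group_add, 'a::{ring, monoid_mult}) ring_grading \<Rightarrow> ('l, 'a) ring_grading \<Rightarrow>
   ('l, 'a, 'm::ab_group_add) gbimodule \<Rightarrow> ('l, 'a, 'n::ab_group_add) gbimodule \<Rightarrow> bool" where
  "bimodule_isomorphic R S M N \<longleftrightarrow>
     (\<exists>f. bimodule_hom R S M N f \<and> bij_betw f (dsum (gr M)) (dsum (gr N)))"

definition regular_bimodule ::
  "('l, 'a::times) ring_grading \<Rightarrow> ('l, 'a, 'a) gbimodule" where
  "regular_bimodule R = \<lparr>gr = R, lact = (\<lambda>a x. a * x), ract = (\<lambda>x a. x * a)\<rparr>"

text \<open>\<open>ltwist \<beta> A\<close> and \<open>twist \<beta> \<alpha> A\<close> are \<open>A\<close> with left action through \<open>\<beta>\<close> and, for the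
  latter, right action through \<open>\<alpha>\<close>.\<close>

definition ltwist ::
  "('a::times \<Rightarrow> 'a) \<Rightarrow> ('l, 'a) ring_grading \<Rightarrow> ('l, 'a, 'a) gmodule" where
  "ltwist \<beta> A = \<lparr>gr = A, lact = (\<lambda>b x. \<beta> b * x)\<rparr>"

definition twist ::
  "('a::times \<Rightarrow> 'a) \<Rightarrow> ('a \<Rightarrow> 'a) \<Rightarrow> ('l, 'a) ring_grading \<Rightarrow> ('l, 'a, 'a) gbimodule" where
  "twist \<beta> \<alpha> A = \<lparr>gr = A, lact = (\<lambda>b x. \<beta> b * x), ract = (\<lambda>x a. x * \<alpha> a)\<rparr>"

text \<open>\<open>shift R \<mu> \<gamma> M\<close> is \<open>{\<mu>,\<gamma>}M\<close> for a module \<open>M\<close> whose left coefficient ring is \<open>R\<close>.\<close>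

definition shift ::
  "('l::ab_group_add, 'a::{ring, monoid_mult}) ring_grading \<Rightarrow> 'l \<Rightarrow> bit \<Rightarrow>
   ('l, 'a, 'm::ab_group_add) gbimodule \<Rightarrow> ('l, 'a, 'm) gbimodule" where
  "shift R \<mu> \<gamma> M =
     \<lparr>gr = (\<lambda>(\<nu>, \<delta>). gr M (\<nu> - \<mu>, \<delta> + \<gamma>)),
      lact = (\<lambda>a m. hsum R a (\<lambda>d a'. neg_pow (\<gamma> * snd d) (lact M a' m))),
      ract = ract M\<rparr>"

section \<open>The bimodule of left homomorphisms\<close>

text \<open>
  \<open>HOM_part R M N d\<close> consists of the maps of degree \<open>d\<close>; functions are normalised to be \<open>0\<close>
  off the domain. Nonzero maps of distinct degrees are linearly independent, so the direct sum
  over all degrees is the internal sum \<open>dsum (HOM_part R M N)\<close>.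
\<close>

definition HOM_part ::
  "('l::ab_group_add, 'a::{ring, monoid_mult}) ring_grading \<Rightarrow>
   ('l, 'a, 'm::ab_group_add, 'y) gmodule_scheme \<Rightarrow>
   ('l, 'a, 'n::ab_group_add, 'z) gmodule_scheme \<Rightarrow> 'l \<times> bit \<Rightarrow> ('m \<Rightarrow> 'n) set" where
  "HOM_part R M N d = {f.
     (\<forall>x. x \<notin> dsum (gr M) \<longrightarrow> f x = 0) \<and>
     (\<forall>x\<in>dsum (gr M). \<forall>y\<in>dsum (gr M). f (x + y) = f x + f y) \<and>
     (\<forall>e. f ` gr M e \<subseteq> gr N (e + d)) \<and>
     (\<forall>e. \<forall>r\<in>R e. \<forall>x\<in>dsum (gr M).
        f (lact M r x) = neg_pow (snd d * snd e) (lact N r (f x)))}"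

text \<open>
  For an \<open>(R,S)\<close>-bimodule \<open>M\<close> and an \<open>(R,T)\<close>-bimodule \<open>N\<close>, this is an \<open>(S,T)\<close>-bimodule with
  \<open>(a \<cdot> f)(x) = (-1)\<^bsup>|a||f| + |a||x|\<^esup> f (x \<cdot> a)\<close> and \<open>(f \<cdot> b)(x) = (-1)\<^bsup>|b||x|\<^esup> f x \<cdot> b\<close>, where
  \<open>x \<cdot> a\<close> and \<open>f x \<cdot> b\<close> are the actions of \<open>M\<close> and \<open>N\<close> and bars denote parities.
\<close>

definition HOM_bimodule ::
  "('l::ab_group_add, 'a::{ring, monoid_mult}) ring_grading \<Rightarrow>
   ('l, 'a) ring_grading \<Rightarrow> ('l, 'a) ring_grading \<Rightarrow>
   ('l, 'a, 'm::ab_group_add) gbimodule \<Rightarrow> ('l, 'a, 'n::ab_group_add) gbimodule \<Rightarrow>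
   ('l, 'a, 'm \<Rightarrow> 'n) gbimodule" where
  "HOM_bimodule R S T M N =
     \<lparr>gr = HOM_part R M N,
      lact = (\<lambda>a f x. hsum S a (\<lambda>d a'. hsum (HOM_part R M N) f (\<lambda>e f'. hsum (gr M) x (\<lambda>h x'.
                neg_pow (snd d * snd e + snd d * snd h) (f' (ract M x' a')))))),
      ract = (\<lambda>f b x. hsum T b (\<lambda>d b'. hsum (gr M) x (\<lambda>h x'.
                neg_pow (snd d * snd h) (ract N (f x') b'))))\<rparr>"


section \<open>Finitely generated and projective modules\<close>

definition finitely_generated ::
  "('l::ab_group_add, 'a::{ring, monoid_mult}) ring_grading \<Rightarrow>
   ('l, 'a, 'm::ab_group_add, 'z) gmodule_scheme \<Rightarrow> bool" where
  "finitely_generated R P \<longleftrightarrow>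
     (\<exists>X. finite X \<and> X \<subseteq> dsum (gr P) \<and>
        (\<forall>x\<in>dsum (gr P). \<exists>c. (\<forall>s\<in>X. c s \<in> dsum R) \<and> x = (\<Sum>s\<in>X. lact P (c s) s)))"

text \<open>
  The lifting property. A definition cannot quantify over the types carrying the test modules;
  the carrier type of \<open>M\<close> below is chosen so that it contains the free graded module on all
  homogeneous elements of \<open>P\<close>. Lemma \<open>projective_lifts\<close> shows that the lifting property then
  holds for test modules on arbitrary types.
\<close>

definition projective ::
  "('l::ab_group_add, 'a::{ring, monoid_mult}) ring_grading \<Rightarrow>
   ('l, 'a, 'p::ab_group_add, 'z) gmodule_scheme \<Rightarrow> bool" where
  "projective R P \<longleftrightarrow>
     (\<forall>(M :: ('l, 'a, ('l \<times> bit) \<times> 'p \<Rightarrow> 'a) gmodule) (N :: ('l, 'a, 'p) gmodule) g f.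
        left_gmodule R M \<longrightarrow> left_gmodule R N \<longrightarrow>
        left_hom R M N g \<longrightarrow> g ` dsum (gr M) = dsum (gr N) \<longrightarrow>
        left_hom R P N f \<longrightarrow>
        (\<exists>h. left_hom R P M h \<and> (\<forall>x\<in>dsum (gr P). g (h x) = f x)))"

context
  notes split_paired_All [simp del] split_paired_Ex [simp del]
begin

lemma part_subset_dsum:
  assumes G: "is_grading G" and x: "x \<in> G d"
  shows "x \<in> dsum G"
proof -
  have 1: "{e. (if e = d then x else 0) \<noteq> 0} = (if x = 0 then {} else {d})" by auto
  have "decomposes G x (\<lambda>e. if e = d then x else 0)"
    unfolding decomposes_def 1 using assms by (auto simp: is_grading_def)
  then show ?thesis by (auto simp: dsum_def)
qed

lemma decomposes_sum:
  assumes "decomposes G x c" and "finite D" and "{d. c d \<noteq> 0} \<subseteq> D"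
  shows "x = (\<Sum>d\<in>D. c d)"
  using assms by (auto simp: decomposes_def intro!: sum.mono_neutral_left)

lemma part_add:
  assumes "is_grading G" "x \<in> G d" "y \<in> G d"
  shows "x + y \<in> G d"
proof -
  have "0 - y \<in> G d" using assms unfolding is_grading_def by blast
  then have "x - (0 - y) \<in> G d" using assms unfolding is_grading_def by blast
  then show ?thesis by simp
qed

lemma dsum_add:
  assumes G: "is_grading G" and x: "x \<in> dsum G" and y: "y \<in> dsum G"
  shows "x + y \<in> dsum G"
proof -
  obtain c c' where c: "decomposes G x c" and c': "decomposes G y c'"
    using x y by (auto simp: dsum_def)
  let ?D = "{d. c d \<noteq> 0} \<union> {d. c' d \<noteq> 0}"
  have fin: "finite ?D" using c c' by (auto simp: decomposes_def)
  have "x + y = (\<Sum>d\<in>?D. c d + c' d)"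
    using decomposes_sum[OF c fin] decomposes_sum[OF c' fin] by (simp add: sum.distrib)
  also have "\<dots> = (\<Sum>d | c d + c' d \<noteq> 0. c d + c' d)"
    using fin by (intro sum.mono_neutral_right) auto
  finally have "decomposes G (x + y) (\<lambda>d. c d + c' d)"
    using c c' unfolding decomposes_def
    by (auto intro: part_add[OF G] rev_finite_subset[OF fin])
  then show ?thesis by (auto simp: dsum_def)
qed

lemma dsum_zero: "is_grading G \<Longrightarrow> 0 \<in> dsum G"
  by (rule part_subset_dsum) (auto simp: is_grading_def)

lemma dsum_sum:
  assumes "is_grading G" and "\<And>i. i \<in> I \<Longrightarrow> x i \<in> dsum G"
  shows "(\<Sum>i\<in>I. x i) \<in> dsum G"
  using assms(2) by (induction I rule: infinite_finite_induct) (auto simp: assms dsum_zero dsum_add)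

lemma part_sum:
  assumes "is_grading G" and "\<And>i. i \<in> I \<Longrightarrow> x i \<in> G d"
  shows "(\<Sum>i\<in>I. x i) \<in> G d"
  using assms(2)
proof (induction I rule: infinite_finite_induct)
  case (insert i I) then show ?case by (auto intro: part_add assms)
qed (use assms(1) in \<open>auto simp: is_grading_def\<close>)

lemma dsum_additive_zero:
  assumes "is_grading G" and "\<And>x y. x \<in> dsum G \<Longrightarrow> y \<in> dsum G \<Longrightarrow> f (x + y) = f x + f y"
  shows "f 0 = (0::'a::ab_group_add)"
  using assms(2)[OF dsum_zero dsum_zero, OF assms(1) assms(1)] by simp

lemma dsum_additive_sum:
  assumes G: "is_grading G" and f: "\<And>x y. x \<in> dsum G \<Longrightarrow> y \<in> dsum G \<Longrightarrow> f (x + y) = f x + f y"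
    and "\<And>i. i \<in> I \<Longrightarrow> x i \<in> dsum G"
  shows "f (\<Sum>i\<in>I. x i) = (\<Sum>i\<in>I. f (x i) :: 'a::ab_group_add)"
  using assms(3)
proof (induction I rule: infinite_finite_induct)
  case (insert i I)
  then show ?case using dsum_sum[OF G, of I x] by (simp add: f)
qed (simp_all add: dsum_additive_zero[OF G f])

lemma lact_dsum:
  assumes R: "graded_superring R" and M: "left_gmodule R M"
    and r: "r \<in> dsum R" and x: "x \<in> dsum (gr M)"
  shows "lact M r x \<in> dsum (gr M)"
proof -
  have gR: "is_grading R" and gM: "is_grading (gr M)"
    using R M by (auto simp: graded_superring_def left_gmodule_def)
  obtain c c' where c: "decomposes R r c" and c': "decomposes (gr M) x c'"
    using r x by (auto simp: dsum_def)
  have cR: "c d \<in> dsum R" and cM: "c' e \<in> dsum (gr M)" for d e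
    using c c' by (auto simp: decomposes_def intro: part_subset_dsum gR gM)
  let ?D = "{d. c d \<noteq> 0}" and ?E = "{e. c' e \<noteq> 0}"
  have r_eq: "r = (\<Sum>d\<in>?D. c d)" and x_eq: "x = (\<Sum>e\<in>?E. c' e)"
    using c c' by (auto simp: decomposes_def)
  have "lact M r x = (\<Sum>d\<in>?D. lact M (c d) x)"
    unfolding r_eq
    by (rule dsum_additive_sum[OF gR, where f = "\<lambda>r. lact M r x"])
      (use M x cR in \<open>(unfold left_gmodule_def, blast)+\<close>)
  also have "\<dots> = (\<Sum>d\<in>?D. \<Sum>e\<in>?E. lact M (c d) (c' e))"
  proof (rule sum.cong[OF refl])
    fix d
    show "lact M (c d) x = (\<Sum>e\<in>?E. lact M (c d) (c' e))"
      unfolding x_eq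
      by (rule dsum_additive_sum[OF gM, where f = "\<lambda>x. lact M (c d) x"])
        (use M cR[of d] cM in \<open>(unfold left_gmodule_def, blast)+\<close>)
  qed
  also have "\<dots> \<in> dsum (gr M)"
  proof (intro dsum_sum[OF gM])
    fix d e
    have "lact M (c d) (c' e) \<in> gr M (d + e)"
      using M c c' by (auto simp: left_gmodule_def decomposes_def)
    then show "lact M (c d) (c' e) \<in> dsum (gr M)" by (rule part_subset_dsum[OF gM])
  qed
  finally show ?thesis .
qed

text \<open>The free graded module on all homogeneous elements \<open>i = (e, p)\<close>, \<open>p\<close> of degree \<open>e\<close>.\<close>

definition free_cover ::
  "('l::ab_group_add, 'a::{ring, monoid_mult}) ring_grading \<Rightarrow>
   ('l, 'a, 'p::ab_group_add, 'z) gmodule_scheme \<Rightarrow> ('l, 'a, ('l \<times> bit) \<times> 'p \<Rightarrow> 'a) gmodule" where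
  "free_cover R P =
     \<lparr>gr = (\<lambda>d. {\<phi>. finite {i. \<phi> i \<noteq> 0} \<and>
             (\<forall>i. \<phi> i \<in> (if snd i \<in> gr P (fst i) then R (d - fst i) else {0}))}),
      lact = (\<lambda>b \<phi> i. b * \<phi> i)\<rparr>"

lemma sum_fun_apply: "(\<Sum>d\<in>D. c d) i = (\<Sum>d\<in>D. c d i)"
  by (induction D rule: infinite_finite_induct) auto

lemma free_cover_part:
  assumes "x \<in> gr (free_cover R P) d"
  shows "x i \<in> (if snd i \<in> gr P (fst i) then R (d - fst i) else {0})"
proof -
  have "\<forall>i. x i \<in> (if snd i \<in> gr P (fst i) then R (d - fst i) else {0})"
    using assms by (simp add: free_cover_def)
  then show ?thesis by blast
qed

lemma decomposes_apply:
  assumes "decomposes G x c"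
  shows "x i = (\<Sum>d | c d \<noteq> 0. c d i)"
proof -
  have "x = (\<Sum>d | c d \<noteq> 0. c d)" using assms unfolding decomposes_def by blast
  from fun_cong[OF this, of i] show ?thesis unfolding sum_fun_apply .
qed

lemma free_cover_graded:
  assumes R: "graded_superring R"
  shows "is_grading (gr (free_cover R P))"
proof -
  let ?F = "gr (free_cover R P)"
  have gR: "is_grading R" using R by (simp add: graded_superring_def)
  have z: "0 \<in> R d" and s: "\<lbrakk>x \<in> R d; y \<in> R d\<rbrakk> \<Longrightarrow> x - y \<in> R d" for x y d
    using gR by (auto simp: is_grading_def)
  have Fz: "0 \<in> ?F d" for d by (auto simp: free_cover_def z)
  have Fs: "x - y \<in> ?F d" if "x \<in> ?F d" "y \<in> ?F d" for x y d
  proof -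
    have "finite ({i. x i \<noteq> 0} \<union> {i. y i \<noteq> 0})" using that by (simp add: free_cover_def)
    then have "finite {i. (x - y) i \<noteq> 0}" by (rule rev_finite_subset) auto
    moreover have "(x - y) i \<in> (if snd i \<in> gr P (fst i) then R (d - fst i) else {0})" for i
      using free_cover_part[OF that(1), of i] free_cover_part[OF that(2), of i]
      by (simp add: s split: if_splits)
    ultimately show ?thesis by (simp add: free_cover_def)
  qed
  have dec: "decomposes R (x i) (\<lambda>d. c (d + fst i) i)"
    if c: "decomposes ?F x c" and i: "snd i \<in> gr P (fst i)" for x c i
  proof -
    have "c d \<in> ?F d" for d using c by (simp add: decomposes_def)
    from free_cover_part[OF this, of _ i] i have 1: "c d i \<in> R (d - fst i)" for d by simp
    have fin: "finite {d. c d \<noteq> 0}" using c by (auto simp: decomposes_def)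
    have fin': "finite {d. c d i \<noteq> 0}" by (rule finite_subset[OF _ fin]) auto
    have img: "{d. c (d + fst i) i \<noteq> 0} = (\<lambda>d. d - fst i) ` {d. c d i \<noteq> 0}"
      by (force simp: image_iff intro: exI[of _ "_ + fst i"])
    have "x i = (\<Sum>d | c d \<noteq> 0. c d i)"
      by (rule decomposes_apply[OF c])
    also have "\<dots> = (\<Sum>d | c d i \<noteq> 0. c d i)"
      by (rule sum.mono_neutral_right) (use fin in auto)
    also have "\<dots> = (\<Sum>d | c (d + fst i) i \<noteq> 0. c (d + fst i) i)"
      unfolding img by (subst sum.reindex) (auto simp: inj_on_def)
    finally show ?thesis
      using 1[of "_ + fst i"] fin' unfolding decomposes_def by (simp add: img)
  qed
  have "c = c'" if c: "decomposes ?F x c" and c': "decomposes ?F x c'" for x c c'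
  proof (intro ext)
    fix d i
    show "c d i = c' d i"
    proof (cases "snd i \<in> gr P (fst i)")
      case True
      have "(\<lambda>d. c (d + fst i) i) = (\<lambda>d. c' (d + fst i) i)"
        using dec[OF c True] dec[OF c' True] gR unfolding is_grading_def by blast
      from fun_cong[OF this, of "d - fst i"] show ?thesis by simp
    next
      case False
      have "c d \<in> ?F d" "c' d \<in> ?F d" using c c' by (auto simp: decomposes_def)
      from free_cover_part[OF this(1), of i] free_cover_part[OF this(2), of i] False
      show ?thesis by simp
    qed
  qed
  then show ?thesis unfolding is_grading_def using Fz Fs by blast
qed

lemma free_cover_gmodule:
  assumes R: "graded_superring R"
  shows "left_gmodule R (free_cover R P)"
proof -
  have gR: "is_grading R" using R by (simp add: graded_superring_def)
  have "lact (free_cover R P) r x \<in> gr (free_cover R P) (d + e)"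
    if r: "r \<in> R d" and x: "x \<in> gr (free_cover R P) e" for d e r x
  proof -
    have "finite {i. x i \<noteq> 0}" using x by (simp add: free_cover_def)
    then have "finite {i. r * x i \<noteq> 0}" by (rule rev_finite_subset) auto
    moreover have "r * x i \<in> (if snd i \<in> gr P (fst i) then R (d + e - fst i) else {0})" for i
    proof -
      have "x i \<in> (if snd i \<in> gr P (fst i) then R (e - fst i) else {0})"
        using x by (simp add: free_cover_def)
      moreover have "r * x i \<in> R (d + (e - fst i))" if "x i \<in> R (e - fst i)"
        using R r that unfolding graded_superring_def by blast
      ultimately show ?thesis by (auto simp: add_diff_eq split: if_splits)
    qed
    ultimately show ?thesis by (simp add: free_cover_def)
  qed
  moreover have "lact (free_cover R P) r (x + y) = lact (free_cover R P) r x + lact (free_cover R P) r y"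
    "lact (free_cover R P) (r + s) x = lact (free_cover R P) r x + lact (free_cover R P) s x"
    "lact (free_cover R P) (r * s) x = lact (free_cover R P) r (lact (free_cover R P) s x)"
    "lact (free_cover R P) 1 x = x" for r s x y
    by (simp_all add: free_cover_def fun_eq_iff distrib_left distrib_right mult.assoc)
  ultimately show ?thesis
    using free_cover_graded[OF R] unfolding left_gmodule_def by blast
qed

lemma free_cover_dsum:
  assumes R: "graded_superring R" and x: "x \<in> dsum (gr (free_cover R P))"
  shows "finite {i. x i \<noteq> 0}" and "x i \<in> dsum R" and "x i \<noteq> 0 \<Longrightarrow> snd i \<in> gr P (fst i)"
proof -
  have gR: "is_grading R" using R by (simp add: graded_superring_def)
  obtain c where c: "decomposes (gr (free_cover R P)) x c" using x by (auto simp: dsum_def)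
  let ?D = "{d. c d \<noteq> 0}"
  have fin: "finite ?D" and cF: "\<And>d. c d \<in> gr (free_cover R P) d"
    using c by (auto simp: decomposes_def)
  have xi: "x i = (\<Sum>d\<in>?D. c d i)" for i
    by (rule decomposes_apply[OF c])
  have "finite {i. c d i \<noteq> 0}" for d using cF[of d] by (simp add: free_cover_def)
  then have "finite (\<Union>d\<in>?D. {i. c d i \<noteq> 0})" by (intro finite_UN_I fin)
  moreover have "{i. x i \<noteq> 0} \<subseteq> (\<Union>d\<in>?D. {i. c d i \<noteq> 0})"
  proof
    fix i assume "i \<in> {i. x i \<noteq> 0}"
    then have "(\<Sum>d\<in>?D. c d i) \<noteq> 0" using xi[of i] by simp
    then obtain d where "d \<in> ?D" "c d i \<noteq> 0" by (rule sum.not_neutral_contains_not_neutral)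
    then show "i \<in> (\<Union>d\<in>?D. {i. c d i \<noteq> 0})" by blast
  qed
  ultimately show "finite {i. x i \<noteq> 0}" by (rule rev_finite_subset)
  have cR: "c d i \<in> dsum R" for d i
  proof (cases "snd i \<in> gr P (fst i)")
    case True
    then have "c d i \<in> R (d - fst i)" using free_cover_part[OF cF, of d i] by simp
    then show ?thesis by (rule part_subset_dsum[OF gR])
  next
    case False
    then have "c d i = 0" using free_cover_part[OF cF, of d i] by simp
    then show ?thesis by (simp add: dsum_zero[OF gR])
  qed
  show "x i \<in> dsum R" unfolding xi by (rule dsum_sum[OF gR cR])
  show "snd i \<in> gr P (fst i)" if "x i \<noteq> 0"
  proof (rule ccontr)
    assume "snd i \<notin> gr P (fst i)"
    then have "c d i = 0" for d using free_cover_part[OF cF, of d i] by simp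
    with that xi[of i] show False by simp
  qed
qed

definition free_eval ::
  "('l, 'a, 'm::ab_group_add, 'z) gmodule_scheme \<Rightarrow> ('i \<Rightarrow> 'm) \<Rightarrow> ('i \<Rightarrow> 'a::zero) \<Rightarrow> 'm" where
  "free_eval M m \<phi> = (\<Sum>i | \<phi> i \<noteq> 0. lact M (\<phi> i) (m i))"

lemma left_gmodule_add_left:
  assumes "left_gmodule R M" "r \<in> dsum R" "s \<in> dsum R" "x \<in> dsum (gr M)"
  shows "lact M (r + s) x = lact M r x + lact M s x"
  using assms unfolding left_gmodule_def by simp

lemma left_gmodule_zero:
  assumes R: "graded_superring R" and M: "left_gmodule R M" and x: "x \<in> dsum (gr M)"
  shows "lact M 0 x = 0"
proof -
  have "0 \<in> dsum R" using R by (simp add: graded_superring_def dsum_zero)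
  from left_gmodule_add_left[OF M this this x] show ?thesis by simp
qed

lemma free_eval_hom:
  assumes R: "graded_superring R" and M: "left_gmodule R M"
    and m: "\<And>i. snd i \<in> gr P (fst i) \<Longrightarrow> m i \<in> gr M (fst i)"
  shows "left_hom R (free_cover R P) M (free_eval M m)"
proof -
  let ?F = "free_cover R P"
  have gR: "is_grading R" and gM: "is_grading (gr M)"
    using R M by (auto simp: graded_superring_def left_gmodule_def)
  have mM: "m i \<in> dsum (gr M)" if "snd i \<in> gr P (fst i)" for i
    using m[OF that] by (rule part_subset_dsum[OF gM])
  note zero = left_gmodule_zero[OF R M]
  have ext: "free_eval M m x = (\<Sum>i\<in>I. lact M (x i) (m i))"
    if "x \<in> dsum (gr ?F)" "finite I" "{i. x i \<noteq> 0} \<subseteq> I" "\<forall>i\<in>I. snd i \<in> gr P (fst i)" for x I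
    unfolding free_eval_def
    by (rule sum.mono_neutral_left) (use that zero mM in auto)
  have add: "free_eval M m (x + y) = free_eval M m x + free_eval M m y"
    if x: "x \<in> dsum (gr ?F)" and y: "y \<in> dsum (gr ?F)" for x y
  proof -
    let ?I = "{i. x i \<noteq> 0} \<union> {i. y i \<noteq> 0}"
    have xy: "x + y \<in> dsum (gr ?F)" by (rule dsum_add[OF free_cover_graded[OF R] x y])
    have fin: "finite ?I" using free_cover_dsum(1)[OF R x] free_cover_dsum(1)[OF R y] by auto
    have I: "\<forall>i\<in>?I. snd i \<in> gr P (fst i)"
      using free_cover_dsum(3)[OF R x] free_cover_dsum(3)[OF R y] by blast
    have "free_eval M m (x + y) = (\<Sum>i\<in>?I. lact M ((x + y) i) (m i))"
      by (rule ext[OF xy fin _ I]) auto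
    also have "\<dots> = (\<Sum>i\<in>?I. lact M (x i) (m i) + lact M (y i) (m i))"
    proof (rule sum.cong[OF refl])
      fix i assume "i \<in> ?I"
      then have "m i \<in> dsum (gr M)" using I mM by blast
      then show "lact M ((x + y) i) (m i) = lact M (x i) (m i) + lact M (y i) (m i)"
        using M free_cover_dsum(2)[OF R x, of i] free_cover_dsum(2)[OF R y, of i]
        unfolding left_gmodule_def plus_fun_apply by blast
    qed
    also have "\<dots> = free_eval M m x + free_eval M m y"
      unfolding sum.distrib using ext[OF x fin _ I] ext[OF y fin _ I] by auto
    finally show ?thesis .
  qed
  have deg: "free_eval M m x \<in> gr M d" if x: "x \<in> gr ?F d" for x d
    unfolding free_eval_def
  proof (rule part_sum[OF gM])
    fix i assume "i \<in> {i. x i \<noteq> 0}"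
    then have i: "snd i \<in> gr P (fst i)" and xi: "x i \<in> R (d - fst i)"
      using free_cover_part[OF x, of i] by (auto split: if_splits)
    have "lact M (x i) (m i) \<in> gr M (d - fst i + fst i)"
      using M xi m[OF i] unfolding left_gmodule_def by blast
    then show "lact M (x i) (m i) \<in> gr M d" by simp
  qed
  have lin: "free_eval M m (lact ?F r x) = lact M r (free_eval M m x)"
    if r: "r \<in> dsum R" and x: "x \<in> dsum (gr ?F)" for r x
  proof -
    let ?I = "{i. x i \<noteq> 0}"
    have rx: "lact ?F r x \<in> dsum (gr ?F)" by (rule lact_dsum[OF R free_cover_gmodule[OF R] r x])
    have fin: "finite ?I" by (rule free_cover_dsum(1)[OF R x])
    have I: "\<forall>i\<in>?I. snd i \<in> gr P (fst i)" using free_cover_dsum(3)[OF R x] by blast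
    have "free_eval M m (lact ?F r x) = (\<Sum>i\<in>?I. lact M (lact ?F r x i) (m i))"
      by (rule ext[OF rx fin _ I]) (auto simp: free_cover_def)
    also have "\<dots> = (\<Sum>i\<in>?I. lact M r (lact M (x i) (m i)))"
    proof (rule sum.cong[OF refl])
      fix i assume "i \<in> ?I"
      then have "m i \<in> dsum (gr M)" using I mM by blast
      then have "lact M (r * x i) (m i) = lact M r (lact M (x i) (m i))"
        using M r free_cover_dsum(2)[OF R x, of i] unfolding left_gmodule_def by blast
      then show "lact M (lact ?F r x i) (m i) = lact M r (lact M (x i) (m i))"
        by (simp add: free_cover_def)
    qed
    also have "\<dots> = lact M r (free_eval M m x)"
      unfolding free_eval_def
    proof (rule dsum_additive_sum[OF gM, where f = "lact M r", symmetric])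
      show "lact M r (u + v) = lact M r u + lact M r v"
        if "u \<in> dsum (gr M)" "v \<in> dsum (gr M)" for u v
        using M r that unfolding left_gmodule_def by blast
      show "lact M (x i) (m i) \<in> dsum (gr M)" if "i \<in> ?I" for i
        using that I mM by (intro lact_dsum[OF R M free_cover_dsum(2)[OF R x]]) blast
    qed
    finally show ?thesis .
  qed
  show ?thesis unfolding left_hom_def using add deg lin by blast
qed

lemma left_hom_dsum:
  assumes "is_grading (gr M)" "is_grading (gr N)" and f: "left_hom R M N f"
    and x: "x \<in> dsum (gr M)"
  shows "f x \<in> dsum (gr N)"
proof -
  obtain c where c: "decomposes (gr M) x c" using x by (auto simp: dsum_def)
  have "f x = (\<Sum>d | c d \<noteq> 0. f (c d))"
    using c f by (auto simp: decomposes_def left_hom_def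
        intro!: dsum_additive_sum[OF assms(1)] part_subset_dsum[OF assms(1)])
  also have "\<dots> \<in> dsum (gr N)"
  proof (rule dsum_sum[OF assms(2)])
    fix d
    have "f (c d) \<in> gr N d" using c f unfolding decomposes_def left_hom_def by blast
    then show "f (c d) \<in> dsum (gr N)" by (rule part_subset_dsum[OF assms(2)])
  qed
  finally show ?thesis .
qed

lemma left_hom_surj_part:
  assumes gM: "is_grading (gr M)" and gN: "is_grading (gr N)" and g: "left_hom R M N g"
    and surj: "dsum (gr N) \<subseteq> g ` dsum (gr M)" and y: "y \<in> gr N e"
  shows "\<exists>x\<in>gr M e. g x = y"
proof -
  obtain x where x: "x \<in> dsum (gr M)" "y = g x"
    using part_subset_dsum[of "gr N", OF gN y] surj by blast
  obtain c where c: "decomposes (gr M) x c" using x by (auto simp: dsum_def)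
  have cd: "c d \<in> gr M d" for d using c unfolding decomposes_def by blast
  have cM: "c d \<in> dsum (gr M)" for d using cd by (rule part_subset_dsum[OF gM])
  have gc: "g (c d) \<in> gr N d" for d using cd g unfolding left_hom_def by blast
  have add: "g (u + v) = g u + g v" if "u \<in> dsum (gr M)" "v \<in> dsum (gr M)" for u v
    using g that by (auto simp: left_hom_def)
  have g0: "g 0 = 0" by (rule dsum_additive_zero[OF gM add])
  have fin: "finite {d. c d \<noteq> 0}" using c by (auto simp: decomposes_def)
  have sub: "{d. g (c d) \<noteq> 0} \<subseteq> {d. c d \<noteq> 0}" using g0 by auto
  have "y = (\<Sum>d | c d \<noteq> 0. g (c d))"
    unfolding x using c
    by (auto simp: decomposes_def intro!: dsum_additive_sum[OF gM add] cM)
  also have "\<dots> = (\<Sum>d | g (c d) \<noteq> 0. g (c d))"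
    by (rule sum.mono_neutral_right[OF fin sub]) auto
  finally have 1: "decomposes (gr N) y (\<lambda>d. g (c d))"
    using gc finite_subset[OF sub fin] by (simp add: decomposes_def)
  have "{d. (if d = e then y else 0) \<noteq> 0} = (if y = 0 then {} else {e})" by auto
  then have 2: "decomposes (gr N) y (\<lambda>d. if d = e then y else 0)"
    using y gN by (auto simp: decomposes_def is_grading_def)
  have "(\<lambda>d. g (c d)) = (\<lambda>d. if d = e then y else 0)"
    using 1 2 gN unfolding is_grading_def by blast
  from fun_cong[OF this, of e] show ?thesis using c by (auto simp: decomposes_def)
qed

lemma free_cover_surj:
  fixes P :: "('l::ab_group_add, 'a::{ring, monoid_mult}, 'p::ab_group_add, 'z) gmodule_scheme"
  assumes R: "graded_superring R" and P: "left_gmodule R P"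
  shows "free_eval P snd ` dsum (gr (free_cover R P)) = dsum (gr P)"
proof
  have gF: "is_grading (gr (free_cover R P))" by (rule free_cover_graded[OF R])
  have gP: "is_grading (gr P)" using P by (simp add: left_gmodule_def)
  have h: "left_hom R (free_cover R P) P (free_eval P snd)" by (rule free_eval_hom[OF R P])
  show "free_eval P snd ` dsum (gr (free_cover R P)) \<subseteq> dsum (gr P)"
    using left_hom_dsum[OF gF gP h] by blast
  show "dsum (gr P) \<subseteq> free_eval P snd ` dsum (gr (free_cover R P))"
  proof
    fix x assume "x \<in> dsum (gr P)"
    then obtain c where c: "decomposes (gr P) x c" by (auto simp: dsum_def)
    define \<delta> :: "'l \<times> bit \<Rightarrow> ('l \<times> bit) \<times> 'p \<Rightarrow> 'a"
      where "\<delta> d = (\<lambda>i. if i = (d, c d) then 1 else 0)" for d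
    have cP: "c d \<in> gr P d" for d using c by (auto simp: decomposes_def)
    have supp: "{i. \<delta> d i \<noteq> 0} = (if (1::'a) = 0 then {} else {(d, c d)})" for d
      by (auto simp: \<delta>_def)
    have zR: "0 \<in> R e" and oR: "1 \<in> R 0" for e using R by (auto simp: graded_superring_def is_grading_def)
    have "finite {i. \<delta> d i \<noteq> 0}" for d unfolding supp by simp
    moreover have "\<delta> d i \<in> (if snd i \<in> gr P (fst i) then R (d - fst i) else {0})" for d i
      using cP[of d] zR oR unfolding \<delta>_def by simp
    ultimately have "\<delta> d \<in> gr (free_cover R P) d" for d
      unfolding free_cover_def by simp
    then have \<delta>F: "\<delta> d \<in> dsum (gr (free_cover R P))" for d by (rule part_subset_dsum[OF gF])
    have ev: "free_eval P snd (\<delta> d) = c d" for d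
    proof -
      have cd: "c d \<in> dsum (gr P)" using cP by (rule part_subset_dsum[OF gP])
      have one: "lact P 1 (c d) = c d"
        using P cd part_subset_dsum[where G = R, OF _ oR] R
        unfolding left_gmodule_def graded_superring_def by blast
      show ?thesis
      proof (cases "(1::'a) = 0")
        case True
        then have "c d = 0" using one left_gmodule_zero[OF R P cd] by simp
        then show ?thesis using True by (simp add: free_eval_def supp)
      next
        case False
        then show ?thesis by (simp add: free_eval_def supp) (simp add: \<delta>_def one)
      qed
    qed
    have "free_eval P snd (\<Sum>d | c d \<noteq> 0. \<delta> d) = (\<Sum>d | c d \<noteq> 0. free_eval P snd (\<delta> d))"
      using h unfolding left_hom_def by (intro dsum_additive_sum[OF gF] \<delta>F) blast
    also have "\<dots> = x" using c by (simp add: ev decomposes_def)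
    finally have "x = free_eval P snd (\<Sum>d | c d \<noteq> 0. \<delta> d)" by (rule sym)
    then show "x \<in> free_eval P snd ` dsum (gr (free_cover R P))"
      by (rule image_eqI[where f = "free_eval P snd"]) (rule dsum_sum[OF gF \<delta>F])
  qed
qed

lemma left_hom_free_eval:
  assumes R: "graded_superring R" and M: "left_gmodule R M" and g: "left_hom R M N g"
    and m: "\<And>i. snd i \<in> gr P (fst i) \<Longrightarrow> m i \<in> gr M (fst i)"
    and x: "x \<in> dsum (gr (free_cover R P))"
  shows "g (free_eval M m x) = free_eval N (\<lambda>i. g (m i)) x"
proof -
  have gM: "is_grading (gr M)" using M by (simp add: left_gmodule_def)
  have mM: "m i \<in> dsum (gr M)" if "x i \<noteq> 0" for i
    using m[OF free_cover_dsum(3)[OF R x that]] by (rule part_subset_dsum[OF gM])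
  have "g (free_eval M m x) = (\<Sum>i | x i \<noteq> 0. g (lact M (x i) (m i)))"
    unfolding free_eval_def
  proof (rule dsum_additive_sum[OF gM])
    show "g (u + v) = g u + g v" if "u \<in> dsum (gr M)" "v \<in> dsum (gr M)" for u v
      using g that unfolding left_hom_def by blast
    show "lact M (x i) (m i) \<in> dsum (gr M)" if "i \<in> {i. x i \<noteq> 0}" for i
      using that mM by (intro lact_dsum[OF R M free_cover_dsum(2)[OF R x]]) blast
  qed
  also have "\<dots> = free_eval N (\<lambda>i. g (m i)) x"
    unfolding free_eval_def
  proof (rule sum.cong[OF refl])
    fix i assume "i \<in> {i. x i \<noteq> 0}"
    then have "m i \<in> dsum (gr M)" using mM by blast
    then show "g (lact M (x i) (m i)) = lact N (x i) (g (m i))"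
      using g free_cover_dsum(2)[OF R x, of i] unfolding left_hom_def by blast
  qed
  finally show ?thesis .
qed

lemma left_hom_comp:
  assumes "is_grading (gr L)" "is_grading (gr M)" "left_hom R L M f" "left_hom R M N g"
  shows "left_hom R L N (\<lambda>x. g (f x))"
proof -
  have "f x \<in> dsum (gr M)" if "x \<in> dsum (gr L)" for x
    by (rule left_hom_dsum[OF assms(1,2,3) that])
  then show ?thesis using assms(3,4) unfolding left_hom_def image_subset_iff by simp
qed

theorem projective_lifts:
  fixes P :: "('l::ab_group_add, 'a::{ring, monoid_mult}, 'p::ab_group_add, 'x) gmodule_scheme"
    and M :: "('l, 'a, 'm::ab_group_add, 'y) gmodule_scheme"
    and N :: "('l, 'a, 'n::ab_group_add, 'z) gmodule_scheme"
  assumes R: "graded_superring R" and P: "left_gmodule R P" and proj: "projective R P"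
    and M: "left_gmodule R M" and N: "left_gmodule R N"
    and g: "left_hom R M N g" and surj: "g ` dsum (gr M) = dsum (gr N)"
    and f: "left_hom R P N f"
  shows "\<exists>h. left_hom R P M h \<and> (\<forall>x\<in>dsum (gr P). g (h x) = f x)"
proof -
  have gM: "is_grading (gr M)" and gN: "is_grading (gr N)" and gP: "is_grading (gr P)"
    using M N P by (auto simp: left_gmodule_def)
  have gF: "is_grading (gr (free_cover R P))" by (rule free_cover_graded[OF R])
  define P' :: "('l, 'a, 'p) gmodule" where "P' = \<lparr>gr = gr P, lact = lact P\<rparr>"
  have P': "left_gmodule R P'" using P by (simp add: P'_def left_gmodule_def)
  have ev: "left_hom R (free_cover R P) P' (free_eval P snd)"
    using free_eval_hom[OF R P, of P snd] by (simp add: P'_def left_hom_def)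
  have evs: "free_eval P snd ` dsum (gr (free_cover R P)) = dsum (gr P')"
    using free_cover_surj[OF R P] by (simp add: P'_def)
  have id: "left_hom R P P' (\<lambda>x. x)" by (simp add: P'_def left_hom_def)
  have "\<exists>s. left_hom R P (free_cover R P) s \<and> (\<forall>x\<in>dsum (gr P). free_eval P snd (s x) = x)"
    by (rule proj[unfolded projective_def, rule_format,
          OF free_cover_gmodule[OF R] P' ev evs id])
  then obtain s where
    s: "left_hom R P (free_cover R P) s" and s': "\<forall>x\<in>dsum (gr P). free_eval P snd (s x) = x"
    by blast
  define m where "m i = (SOME x. x \<in> gr M (fst i) \<and> g x = f (snd i))" for i
  have m: "m i \<in> gr M (fst i) \<and> g (m i) = f (snd i)" if "snd i \<in> gr P (fst i)" for i
  proof -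
    have "f (snd i) \<in> gr N (fst i)" using f that unfolding left_hom_def by blast
    then have "\<exists>x. x \<in> gr M (fst i) \<and> g x = f (snd i)"
      using left_hom_surj_part[OF gM gN g equalityD2[OF surj]] by blast
    then show ?thesis unfolding m_def by (rule someI_ex)
  qed
  have q: "left_hom R (free_cover R P) M (free_eval M m)"
    using m by (intro free_eval_hom[OF R M]) blast
  have "g (free_eval M m (s x)) = f x" if x: "x \<in> dsum (gr P)" for x
  proof -
    have sx: "s x \<in> dsum (gr (free_cover R P))" by (rule left_hom_dsum[OF gP gF s x])
    have "g (free_eval M m (s x)) = free_eval N (\<lambda>i. g (m i)) (s x)"
      using m by (intro left_hom_free_eval[OF R M g _ sx]) blast
    also have "\<dots> = free_eval N (\<lambda>i. f (snd i)) (s x)"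
      unfolding free_eval_def using m free_cover_dsum(3)[OF R sx] by (intro sum.cong) auto
    also have "\<dots> = f (free_eval P snd (s x))"
      by (rule left_hom_free_eval[OF R P f _ sx, symmetric])
    also have "\<dots> = f x" using s' x by simp
    finally show ?thesis .
  qed
  then show ?thesis using left_hom_comp[OF gP gF s q] by blast
qed

end


section \<open>Frobenius extensions\<close>

text \<open>\<open>d = (-\<lambda>, \<pi>)\<close> is the degree of the extension.\<close>

definition frobenius_extension ::
  "('l::ab_group_add, 'a::{ring, monoid_mult}) ring_grading \<Rightarrow> ('l, 'a) ring_grading \<Rightarrow>
   ('a \<Rightarrow> 'a) \<Rightarrow> ('a \<Rightarrow> 'a) \<Rightarrow> 'l \<times> bit \<Rightarrow> bool" where
  "frobenius_extension A B \<alpha> \<beta> d \<longleftrightarrow>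
     (finitely_generated B (regular_bimodule A) \<and> projective B (regular_bimodule A)) \<and>
     bimodule_isomorphic A B (regular_bimodule A)
       (HOM_bimodule B A B (twist \<beta> \<alpha> A) (shift B (- fst d) (snd d) (regular_bimodule B)))"

text \<open>\<open>rmul A a\<close> is the signed right multiplication \<open>\<^sup>ra\<close>, that is \<open>x \<mapsto> (-1)\<^bsup>|a||x|\<^esup> x a\<close>.\<close>

definition rmul ::
  "('l::ab_group_add, 'a::{ring, monoid_mult}) ring_grading \<Rightarrow> 'a \<Rightarrow> 'a \<Rightarrow> 'a" where
  "rmul A a x = hsum A a (\<lambda>d a'. hsum A x (\<lambda>e x'. neg_pow (snd d * snd e) (x' * a')))"

end

theory Submission
  imports Defs
begin

text \<open>
  An isomorphism \<open>\<Phi>\<close> as in (L2) is determined by \<open>tr = \<Phi> 1\<close>, since \<open>\<Phi> a = a \<cdot> tr\<close> is \<open>tr\<close> composed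
  with the signed right multiplication by \<open>\<alpha> a\<close>. Conversely every bimodule map \<open>tr\<close> defines a
  bimodule map \<open>\<Phi>\<close> in this way, whose surjectivity is (L4). Its injectivity is (L3): as \<open>tr\<close>
  preserves degrees, both the vanishing of \<open>tr (x a)\<close> for all \<open>x\<close> and that of its signed version
  amount to \<open>tr (x a') = 0\<close> for all homogeneous \<open>x\<close> and all homogeneous components \<open>a'\<close> of \<open>a\<close>.
\<close>

section \<open>Homogeneous components and additive extension\<close>

text \<open>Degrees stay unsplit variables, and parities keep the \<open>+\<close> and
  \<open>*\<close> of the ring \<open>bit\<close> instead of turning into boolean operations, so
  that ring laws settle the sign exponents.\<close>

declare split_paired_All [simp del] split_paired_Ex [simp del]
  add_bit_eq_xor [simp del] mult_bit_eq_and [simp del]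

lemma grading_zero: "is_grading G \<Longrightarrow> 0 \<in> G d"
  by (simp add: is_grading_def)

lemma grading_diff: "is_grading G \<Longrightarrow> x \<in> G d \<Longrightarrow> y \<in> G d \<Longrightarrow> x - y \<in> G d"
  by (simp add: is_grading_def)

lemma grading_neg_pow:
  assumes "is_grading G" "x \<in> G d"
  shows "neg_pow \<gamma> x \<in> G d"
  using grading_diff[OF assms(1) grading_zero[OF assms(1)] assms(2)] assms(2)
  by (simp add: neg_pow_def)

text \<open>The means of reducing additive identities to homogeneous elements, where signs are
  explicit and each \<open>hsum\<close> collapses to one term.\<close>

lemma dsum_induct [consumes 2, case_names zero add part]:
  assumes "is_grading G" and "x \<in> dsum G"
    and "P 0" and "\<And>x y. x \<in> dsum G \<Longrightarrow> y \<in> dsum G \<Longrightarrow> P x \<Longrightarrow> P y \<Longrightarrow> P (x + y)"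
    and "\<And>d x. x \<in> G d \<Longrightarrow> P x"
  shows "P x"
proof -
  obtain c where c: "decomposes G x c" using assms(2) by (auto simp: dsum_def)
  have cG: "c d \<in> G d" for d using c unfolding decomposes_def by blast
  have "P (\<Sum>d\<in>D. c d)" if "finite D" for D
    using that
  proof (induction D rule: finite_induct)
    case (insert d D)
    have "P (c d + (\<Sum>d\<in>D. c d))"
      by (intro assms(4) dsum_sum part_subset_dsum[OF assms(1) cG] assms(1) insert.IH assms(5)[OF cG])
    then show ?case using insert by simp
  qed (simp add: assms(3))
  then show ?thesis using c unfolding decomposes_def by metis
qed

lemma decomposes_add:
  assumes G: "is_grading G" and c: "decomposes G x c" and c': "decomposes G y c'"
  shows "decomposes G (x + y) (\<lambda>d. c d + c' d)"
proof -
  let ?D = "{d. c d \<noteq> 0} \<union> {d. c' d \<noteq> 0}"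
  have fin: "finite ?D" using c c' by (auto simp: decomposes_def)
  have "x + y = (\<Sum>d\<in>?D. c d + c' d)"
    using decomposes_sum[OF c fin] decomposes_sum[OF c' fin] by (simp add: sum.distrib)
  also have "\<dots> = (\<Sum>d | c d + c' d \<noteq> 0. c d + c' d)"
    using fin by (intro sum.mono_neutral_right) auto
  finally show ?thesis
    using c c' unfolding decomposes_def
    by (auto intro: part_add[OF G] rev_finite_subset[OF fin])
qed

lemma decomposes_part:
  assumes "is_grading G" and "x \<in> G d"
  shows "decomposes G x (\<lambda>e. if e = d then x else 0)"
proof -
  have "{e. (if e = d then x else 0) \<noteq> 0} = (if x = 0 then {} else {d})" by auto
  then show ?thesis using assms by (auto simp: decomposes_def is_grading_def)
qed

lemma hcomp_eq:
  assumes G: "is_grading G" and c: "decomposes G x c"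
  shows "hcomp G d x = c d"
proof -
  have "(THE c. decomposes G x c) = c"
    using G c unfolding is_grading_def by (intro the_equality) blast+
  then show ?thesis using c by (auto simp: hcomp_def dsum_def)
qed

lemma decomposes_hcomp:
  assumes G: "is_grading G" and x: "x \<in> dsum G"
  shows "decomposes G x (\<lambda>d. hcomp G d x)"
proof -
  obtain c where c: "decomposes G x c" using x by (auto simp: dsum_def)
  then show ?thesis using hcomp_eq[OF G c] by simp
qed

text \<open>Off \<open>dsum G\<close> the default value 0 of \<open>hcomp\<close> lies in every
  part.\<close>

lemma hcomp_in_part:
  fixes G :: "'d \<Rightarrow> 'm::ab_group_add set"
  assumes "is_grading G"
  shows "hcomp G d x \<in> G d"
  using decomposes_hcomp[OF assms, of x] grading_zero[OF assms]
  by (cases "x \<in> dsum G") (auto simp: decomposes_def hcomp_def)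

lemma hcomp_part:
  assumes "is_grading G" and "x \<in> G d"
  shows "hcomp G e x = (if e = d then x else 0)"
  by (rule hcomp_eq[OF assms(1) decomposes_part[OF assms]])

lemma hcomp_zero:
  assumes "is_grading G"
  shows "hcomp G d 0 = 0"
  using hcomp_part[OF assms grading_zero[OF assms], of d d] by simp

lemma hcomp_add:
  assumes "is_grading G" "x \<in> dsum G" "y \<in> dsum G"
  shows "hcomp G d (x + y) = hcomp G d x + hcomp G d y"
  by (rule hcomp_eq[OF assms(1)]) (intro decomposes_add decomposes_hcomp assms)

lemma finite_hcomp:
  assumes "is_grading G"
  shows "finite {d. hcomp G d x \<noteq> 0}"
  using decomposes_hcomp[OF assms, of x]
  by (cases "x \<in> dsum G") (auto simp: decomposes_def hcomp_def)

text \<open>For \<open>x = 0\<close> the sum is empty, hence the assumption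
  \<open>F d 0 = 0\<close>.\<close>

lemma hsum_part:
  assumes "is_grading G" and "x \<in> G d" and "F d 0 = 0"
  shows "hsum G x F = F d x"
proof -
  have "{e. hcomp G e x \<noteq> 0} = (if x = 0 then {} else {d})"
    using hcomp_part[OF assms(1,2)] by auto
  then show ?thesis using hcomp_part[OF assms(1,2)] assms(3) by (simp add: hsum_def)
qed

text \<open>Cancellation may shrink the support of \<open>x + y\<close>, so all three sums are taken
  over the union of the supports of \<open>x\<close> and \<open>y\<close>; the added terms vanish
  because additivity forces \<open>F d 0 = 0\<close>.\<close>

lemma hsum_add:
  fixes F :: "'d \<Rightarrow> 'm::ab_group_add \<Rightarrow> 'n::ab_group_add"
  assumes G: "is_grading G" and x: "x \<in> dsum G" and y: "y \<in> dsum G"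
    and F: "\<And>d u v. u \<in> G d \<Longrightarrow> v \<in> G d \<Longrightarrow> F d (u + v) = F d u + F d v"
  shows "hsum G (x + y) F = hsum G x F + hsum G y F"
proof -
  let ?D = "{d. hcomp G d x \<noteq> 0} \<union> {d. hcomp G d y \<noteq> 0}"
  have fin: "finite ?D" using finite_hcomp[OF G] by blast
  have F0: "F d 0 = 0" for d using F[OF grading_zero[OF G, of d] grading_zero[OF G, of d]] by simp
  have ext: "hsum G z F = (\<Sum>d\<in>?D. F d (hcomp G d z))" if "{d. hcomp G d z \<noteq> 0} \<subseteq> ?D" for z
    unfolding hsum_def by (rule sum.mono_neutral_left[OF fin that]) (auto simp: F0)
  have "hsum G (x + y) F = (\<Sum>d\<in>?D. F d (hcomp G d (x + y)))"
    by (rule ext) (auto simp: hcomp_add[OF G x y])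
  also have "\<dots> = (\<Sum>d\<in>?D. F d (hcomp G d x) + F d (hcomp G d y))"
    by (simp add: hcomp_add[OF G x y] F hcomp_in_part[OF G])
  also have "\<dots> = hsum G x F + hsum G y F"
    using ext[of x] ext[of y] by (simp add: sum.distrib)
  finally show ?thesis .
qed

text \<open>The index set depends on \<open>x\<close> alone. In nested sums, \<open>hsum_add\<close>
  treats the variable being split and this rule treats the others.\<close>

lemma hsum_add_fun:
  assumes "is_grading G" and "\<And>d u. u \<in> G d \<Longrightarrow> F d u = F1 d u + F2 d u"
  shows "hsum G x F = hsum G x F1 + hsum G x F2"
  unfolding hsum_def by (simp add: assms(2)[OF hcomp_in_part[OF assms(1)]] sum.distrib)

lemma hsum_zero: "is_grading G \<Longrightarrow> hsum G 0 F = 0"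
  by (simp add: hsum_def hcomp_zero)

lemma hsum_fun_zero: "is_grading G \<Longrightarrow> (\<And>d u. u \<in> G d \<Longrightarrow> F d u = 0) \<Longrightarrow> hsum G x F = 0"
  by (simp add: hsum_def hcomp_in_part)

section \<open>Reindexed gradings and signs\<close>

lemma decomposes_reindex:
  assumes p: "bij p"
  shows "decomposes G x c \<longleftrightarrow> decomposes (\<lambda>d. G (p d)) x (\<lambda>d. c (p d))"
proof -
  have b: "bij_betw p {d. c (p d) \<noteq> 0} {d. c d \<noteq> 0}"
    using p unfolding bij_betw_def by (auto intro: inj_on_subset simp: surj_def image_iff)
  have "(\<Sum>d | c (p d) \<noteq> 0. c (p d)) = (\<Sum>d | c d \<noteq> 0. c d)"
    by (rule sum.reindex_bij_betw[OF b])
  moreover have "(\<forall>d. c (p d) \<in> G (p d)) \<longleftrightarrow> (\<forall>d. c d \<in> G d)"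
    using bij_is_surj[OF p] by (metis surjD)
  ultimately show ?thesis using bij_betw_finite[OF b] by (simp add: decomposes_def)
qed

text \<open>Decompositions are carried back along \<open>inv p\<close>, where uniqueness for
  \<open>G\<close> applies. Shifted modules are the case of a translation \<open>p\<close>.\<close>

lemma is_grading_reindex:
  assumes p: "bij p" and G: "is_grading G"
  shows "is_grading (\<lambda>d. G (p d))"
proof -
  have "c = c'" if "decomposes (\<lambda>d. G (p d)) x c" "decomposes (\<lambda>d. G (p d)) x c'" for x c c'
  proof -
    have eq: "inv p (p d) = d" for d
      using bij_is_inj[OF p] by simp
    have "decomposes G x (\<lambda>d. c (inv p d))" "decomposes G x (\<lambda>d. c' (inv p d))"
      using that by (simp_all add: decomposes_reindex[OF p] eq)
    then have "(\<lambda>d. c (inv p d)) = (\<lambda>d. c' (inv p d))"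
      using G unfolding is_grading_def by blast
    from fun_cong[OF this, of "p _"] show ?thesis by (auto simp: eq)
  qed
  then show ?thesis using G unfolding is_grading_def by blast
qed

lemma neg_pow_simps [simp]:
  "neg_pow 0 x = x" "neg_pow \<gamma> 0 = 0" "neg_pow \<gamma> x = 0 \<longleftrightarrow> x = 0"
  "neg_pow \<gamma> (neg_pow \<delta> x) = neg_pow (\<gamma> + \<delta>) x"
  by (cases \<gamma>; cases \<delta>; simp add: neg_pow_def)+

lemma neg_pow_add: "neg_pow \<gamma> (x + y) = neg_pow \<gamma> x + neg_pow \<gamma> y"
  by (simp add: neg_pow_def)

lemma neg_pow_diff: "neg_pow \<gamma> (x - y) = neg_pow \<gamma> x - neg_pow \<gamma> y"
  by (simp add: neg_pow_def)

lemma neg_pow_mult: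
  fixes x y :: "'a::ring"
  shows "neg_pow \<gamma> x * y = neg_pow \<gamma> (x * y)" "x * neg_pow \<gamma> y = neg_pow \<gamma> (x * y)"
  by (simp_all add: neg_pow_def)

lemma neg_pow_cancel: "neg_pow \<gamma> x = neg_pow \<gamma> y \<longleftrightarrow> x = y"
  by (simp add: neg_pow_def)

lemma additive_neg_pow:
  fixes f :: "'m::ab_group_add \<Rightarrow> 'n::ab_group_add"
  assumes "\<And>x y. f (x + y) = f x + f y"
  shows "f (neg_pow \<gamma> x) = neg_pow \<gamma> (f x)"
proof -
  have "f 0 = 0" using assms[of 0 0] by simp
  then have "f (- x) = - f x" using assms[of x "- x"] by (simp add: eq_neg_iff_add_eq_0 add.commute)
  then show ?thesis by (simp add: neg_pow_def)
qed

lemma regular_bimodule_simps: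
  "gr (regular_bimodule R) = R" "lact (regular_bimodule R) a x = a * x"
  "ract (regular_bimodule R) x a = x * a"
  by (simp_all add: regular_bimodule_def)

section \<open>Homomorphisms into a shifted subring\<close>

text \<open>\<open>total\<close> identifies \<open>A\<close> with its ambient type, so quantifiers
  over \<open>dsum A\<close> become quantifiers over the type, and maps on \<open>A\<close> have no
  values off their domain. \<open>B\<close> is still a subset, and membership in
  \<open>dsum B\<close> has to be tracked.\<close>

locale graded_extension =
  fixes A B :: "('l::ab_group_add, 'a::{ring, monoid_mult}) ring_grading"
    and \<alpha> \<beta> :: "'a \<Rightarrow> 'a" and lam :: 'l and \<pi> :: bit
  assumes A: "graded_superring A" and total: "dsum A = UNIV"
    and B: "graded_subring B A"
    and \<alpha>: "graded_automorphism A \<alpha>" and \<beta>: "graded_automorphism B \<beta>"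
begin

abbreviation N where "N \<equiv> shift B lam \<pi> (regular_bimodule B)"
abbreviation Hom where "Hom \<equiv> HOM_part B (twist \<beta> \<alpha> A) N"
abbreviation H where "H \<equiv> HOM_bimodule B A B (twist \<beta> \<alpha> A) N"

lemma grading_A: "is_grading A" and grading_B: "is_grading B"
  using A B by (auto simp: graded_superring_def graded_subring_def)

lemma B_subset: "x \<in> B d \<Longrightarrow> x \<in> A d"
  using B by (auto simp: graded_subring_def)

lemma mult_A: "x \<in> A d \<Longrightarrow> y \<in> A e \<Longrightarrow> x * y \<in> A (d + e)"
  using A by (simp add: graded_superring_def)

lemma dsum_A [simp]: "x \<in> dsum A"
  by (simp add: total)

lemma A_induct [case_names zero add part]:
  assumes "P 0" "\<And>x y. P x \<Longrightarrow> P y \<Longrightarrow> P (x + y)" "\<And>d x. x \<in> A d \<Longrightarrow> P x"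
  shows "P x"
  using grading_A dsum_A by (induction x rule: dsum_induct) (use assms in auto)

lemma \<alpha>_add: "\<alpha> (x + y) = \<alpha> x + \<alpha> y" and \<alpha>_mult: "\<alpha> (x * y) = \<alpha> x * \<alpha> y"
  and \<alpha>_bij: "bij \<alpha>" and \<alpha>_part: "x \<in> A d \<Longrightarrow> \<alpha> x \<in> A d"
  using \<alpha> unfolding graded_automorphism_def total by blast+

lemma \<alpha>_zero: "\<alpha> 0 = 0"
  using \<alpha>_add[of 0 0] by simp

lemma \<beta>_part: "x \<in> B d \<Longrightarrow> \<beta> x \<in> B d"
  using \<beta> unfolding graded_automorphism_def by blast

text \<open>Addition and subtraction coincide in \<open>bit\<close>, so both coordinates of the
  shift fit into one difference of degrees.\<close>

lemma gr_N: "gr N d = B (d - (lam, \<pi>))"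
  by (cases d) (simp add: shift_def regular_bimodule_def)

lemma grading_N: "is_grading (gr N)"
proof -
  have "bij (\<lambda>d. d - (lam, \<pi>))" by (rule o_bij[where g = "\<lambda>d. d + (lam, \<pi>)"]) (auto simp: fun_eq_iff)
  from is_grading_reindex[OF this grading_B] show ?thesis unfolding gr_N[abs_def] .
qed

lemma lact_N: "r \<in> B d \<Longrightarrow> lact N r m = neg_pow (\<pi> * snd d) (r * m)"
  by (simp add: shift_def regular_bimodule_def hsum_part[OF grading_B])

lemma lact_N_zero: "lact N 0 m = 0"
  by (simp add: shift_def hsum_zero[OF grading_B])

lemma lact_N_add:
  "r \<in> dsum B \<Longrightarrow> s \<in> dsum B \<Longrightarrow> lact N (r + s) m = lact N r m + lact N s m"
  by (simp add: shift_def regular_bimodule_def hsum_add[OF grading_B] distrib_right neg_pow_add)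

lemma Hom_iff:
  "f \<in> Hom d \<longleftrightarrow> (\<forall>x y. f (x + y) = f x + f y) \<and> (\<forall>e. \<forall>x\<in>A e. f x \<in> gr N (e + d)) \<and>
     (\<forall>e. \<forall>r\<in>B e. \<forall>x. f (\<beta> r * x) = neg_pow (snd d * snd e) (lact N r (f x)))"
  by (simp add: HOM_part_def twist_def image_subset_iff total)

lemma Hom_add: "f \<in> Hom d \<Longrightarrow> f (x + y) = f x + f y"
  and Hom_degree: "f \<in> Hom d \<Longrightarrow> x \<in> A e \<Longrightarrow> f x \<in> gr N (e + d)"
  by (simp_all add: Hom_iff)

lemma Hom_zero: "f \<in> Hom d \<Longrightarrow> f 0 = 0"
  using Hom_add[of f d 0 0] by simp

lemma Hom_dsum:
  assumes "f \<in> Hom d"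
  shows "f x \<in> dsum (gr N)"
  by (induction x rule: A_induct)
    (auto simp: Hom_zero[OF assms] Hom_add[OF assms] grading_N dsum_zero dsum_add
      intro: part_subset_dsum[OF grading_N] Hom_degree[OF assms])

lemma Hom_neg_pow: "f \<in> Hom d \<Longrightarrow> f (neg_pow \<gamma> x) = neg_pow \<gamma> (f x)"
  by (rule additive_neg_pow) (rule Hom_add)

text \<open>The sum over degrees is direct because it is so pointwise: on a homogeneous argument,
  maps of different degrees take values in different parts of \<open>N\<close>. Additivity extends
  the equality to all arguments.\<close>

lemma grading_Hom: "is_grading Hom"
proof -
  have "0 \<in> Hom d" for d
    by (auto simp: Hom_iff lact_N grading_zero[OF grading_N])
  moreover have "f - g \<in> Hom d" if "f \<in> Hom d" "g \<in> Hom d" for f g d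
    using that unfolding Hom_iff
    by (auto simp: lact_N grading_diff[OF grading_N] neg_pow_diff right_diff_distrib)
  moreover have "c = c'" if c: "decomposes Hom f c" and c': "decomposes Hom f c'" for f c c'
  proof (intro ext)
    fix d x
    \<comment> \<open>For \<open>y\<close> of degree \<open>e\<close> the part of \<open>N\<close>
      in degree \<open>d\<close> receives the value of the component of degree
      \<open>d - e\<close>.\<close>
    have "decomposes (gr N) (f y) (\<lambda>d. b (d - e) y)" if y: "y \<in> A e" and b: "decomposes Hom f b" for b y e
    proof -
      have bH: "b d \<in> Hom d" for d using b by (simp add: decomposes_def)
      have fin: "finite {d. b d \<noteq> 0}" using b by (simp add: decomposes_def)
      have sub: "{d. b (d - e) y \<noteq> 0} \<subseteq> (\<lambda>d. d + e) ` {d. b d \<noteq> 0}"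
        by (force simp: image_iff intro: exI[of _ "_ - e"])
      have "f y = (\<Sum>d | b d \<noteq> 0. b d y)" by (rule decomposes_apply[OF b])
      also have "\<dots> = (\<Sum>d\<in>(\<lambda>d. d + e) ` {d. b d \<noteq> 0}. b (d - e) y)"
        by (subst sum.reindex) auto
      also have "\<dots> = (\<Sum>d | b (d - e) y \<noteq> 0. b (d - e) y)"
        by (rule sum.mono_neutral_right[OF finite_imageI[OF fin] sub]) auto
      finally show ?thesis
        using finite_subset[OF sub finite_imageI[OF fin]] Hom_degree[OF bH y, of "_ - e"]
        by (simp add: decomposes_def)
    qed
    note dec = this
    have "c d \<in> Hom d" "c' d \<in> Hom d" using c c' by (simp_all add: decomposes_def)
    note hom = this
    show "c d x = c' d x"
    proof (induction x rule: A_induct)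
      case (part e x)
      have "(\<lambda>d. c (d - e) x) = (\<lambda>d. c' (d - e) x)"
        using dec[OF part c] dec[OF part c'] grading_N unfolding is_grading_def by blast
      from fun_cong[OF this, of "d + e"] show ?case by simp
    qed (simp_all add: hom[THEN Hom_zero] hom[THEN Hom_add])
  qed
  ultimately show ?thesis unfolding is_grading_def by blast
qed

section \<open>The two actions on \<open>Hom\<close>\<close>

lemma lact_H:
  "lact H a f x = hsum A a (\<lambda>d a'. hsum Hom f (\<lambda>e f'. hsum A x (\<lambda>h x'.
     neg_pow (snd d * snd e + snd d * snd h) (f' (x' * \<alpha> a')))))"
  by (simp add: HOM_bimodule_def twist_def)

lemma ract_H:
  "ract H f b x = hsum B b (\<lambda>d b'. hsum A x (\<lambda>h x'. neg_pow (snd d * snd h) (f x' * b')))"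
  by (simp add: HOM_bimodule_def twist_def shift_def regular_bimodule_def)

lemma gr_H: "gr H = Hom"
  by (simp add: HOM_bimodule_def)

lemma lact_H_part:
  assumes "a \<in> A d" "f \<in> Hom e" "x \<in> A h"
  shows "lact H a f x = neg_pow (snd d * snd e + snd d * snd h) (f (x * \<alpha> a))"
proof -
  \<comment> \<open>The side condition of \<open>hsum_part\<close> for the outermost sum, whose
    summand must vanish at \<open>a' = 0\<close>.\<close>
  have z: "hsum Hom f (\<lambda>e f'. hsum A x (\<lambda>h x'.
     neg_pow (snd d * snd e + snd d * snd h) (f' (x' * \<alpha> 0)))) = 0"
    by (intro hsum_fun_zero[OF grading_Hom] hsum_fun_zero[OF grading_A])
      (simp add: \<alpha>_zero Hom_zero)
  show ?thesis
    unfolding lact_H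
    by (subst hsum_part[OF grading_A assms(1)], rule z, subst hsum_part[OF grading_Hom assms(2)])
      (simp_all add: hsum_fun_zero[OF grading_A] hsum_part[OF grading_A assms(3)]
        Hom_zero[OF assms(2)])
qed

lemma lact_H_zero: "lact H 0 f x = 0" "lact H a 0 x = 0" "lact H a f 0 = 0"
  by (simp_all add: lact_H hsum_zero grading_A grading_Hom hsum_fun_zero)

lemma lact_H_add_left: "lact H (a + b) f x = lact H a f x + lact H b f x"
  unfolding lact_H
  by (intro hsum_add hsum_add_fun grading_A grading_Hom dsum_A)
    (simp add: \<alpha>_add distrib_left Hom_add neg_pow_add)

lemma lact_H_add_right: "lact H a f (x + y) = lact H a f x + lact H a f y"
  unfolding lact_H
  by (intro hsum_add_fun hsum_add grading_A grading_Hom dsum_A)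
    (simp add: distrib_right Hom_add neg_pow_add)

text \<open>The left action decomposes its map into components, and \<open>hcomp\<close> is additive
  only on the carrier, here \<open>dsum Hom\<close>.\<close>

lemma lact_H_add_fun:
  assumes "f \<in> dsum Hom" "g \<in> dsum Hom"
  shows "lact H a (f + g) x = lact H a f x + lact H a g x"
  unfolding lact_H
  by (intro hsum_add_fun hsum_add grading_A grading_Hom assms) (simp add: neg_pow_add)

text \<open>The sign of the right action does not involve the degree of \<open>f\<close>, so
  \<open>f\<close> is not decomposed; \<open>f 0 = 0\<close> covers the empty sum at
  \<open>x = 0\<close>.\<close>

lemma ract_H_part:
  assumes "b \<in> B d" "x \<in> A h" "f 0 = 0"
  shows "ract H f b x = neg_pow (snd d * snd h) (f x * b)"
  unfolding ract_H
  by (simp add: hsum_part[OF grading_B assms(1)] hsum_fun_zero[OF grading_A]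
      hsum_part[OF grading_A assms(2)] assms(3))

lemma ract_H_zero: "ract H 0 b x = 0" "ract H f 0 x = 0" "ract H f b 0 = 0"
  by (simp_all add: ract_H hsum_zero grading_A grading_B hsum_fun_zero)

lemma ract_H_add_fun: "ract H (f + g) b x = ract H f b x + ract H g b x"
  unfolding ract_H
  by (intro hsum_add_fun grading_A grading_B) (simp add: distrib_right neg_pow_add)

lemma ract_H_add_arg:
  assumes "\<And>x y. f (x + y) = f x + f y"
  shows "ract H f b (x + y) = ract H f b x + ract H f b y"
  unfolding ract_H
  by (intro hsum_add_fun hsum_add grading_A grading_B dsum_A)
    (simp add: assms distrib_right neg_pow_add)

lemma ract_H_add_right:
  assumes "b \<in> dsum B" "c \<in> dsum B"
  shows "ract H f (b + c) x = ract H f b x + ract H f c x"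
  unfolding ract_H
  by (intro hsum_add_fun hsum_add grading_A grading_B assms)
    (simp add: distrib_left neg_pow_add)

section \<open>Signed right multiplication\<close>

lemma rmul_part:
  assumes "a \<in> A d" "x \<in> A h"
  shows "rmul A a x = neg_pow (snd d * snd h) (x * a)"
  unfolding rmul_def
  by (simp add: hsum_part[OF grading_A assms(1)] hsum_fun_zero[OF grading_A]
      hsum_part[OF grading_A assms(2)])

lemma rmul_zero [simp]: "rmul A 0 x = 0" "rmul A a 0 = 0"
  by (simp_all add: rmul_def hsum_zero grading_A hsum_fun_zero)

lemma rmul_add: "rmul A (a + b) x = rmul A a x + rmul A b x"
  "rmul A a (x + y) = rmul A a x + rmul A a y"
  unfolding rmul_def
  by (intro hsum_add_fun hsum_add grading_A dsum_A; simp add: algebra_simps neg_pow_add)+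

section \<open>Trace maps\<close>

text \<open>In degree 0 the sign in \<open>HOM_part\<close> is trivial, so only the scalars differ:
  homogeneous ones there, all of \<open>dsum B\<close> in \<open>left_hom\<close>. Additivity in the
  scalar bridges the gap.\<close>

lemma bimodule_hom_iff:
  "bimodule_hom B B (twist \<beta> \<alpha> A) N tr \<longleftrightarrow>
     tr \<in> Hom 0 \<and> (\<forall>s\<in>dsum B. \<forall>x. tr (x * \<alpha> s) = tr x * s)"
proof -
  have 1: "gr (twist \<beta> \<alpha> A) = A" "lact (twist \<beta> \<alpha> A) r x = \<beta> r * x"
    "ract (twist \<beta> \<alpha> A) x r = x * \<alpha> r" "ract N x r = x * r" for r x
    by (simp_all add: twist_def shift_def regular_bimodule_def)
  have "\<forall>r\<in>dsum B. \<forall>x. tr (\<beta> r * x) = lact N r (tr x)" if tr: "tr \<in> Hom 0"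
  proof (intro ballI allI)
    fix r x assume "r \<in> dsum B"
    with grading_B show "tr (\<beta> r * x) = lact N r (tr x)"
    proof (induction r rule: dsum_induct)
      case zero
      have "\<beta> (0 + 0) = \<beta> 0 + \<beta> 0"
        using \<beta> dsum_zero[OF grading_B] unfolding graded_automorphism_def by blast
      then show ?case by (simp add: lact_N_zero Hom_zero[OF tr])
    next
      case (add r s)
      have "\<beta> (r + s) = \<beta> r + \<beta> s" using \<beta> add(1,2) unfolding graded_automorphism_def by blast
      with add show ?case by (simp add: lact_N_add Hom_add[OF tr] distrib_right)
    next
      case (part d r)
      then show ?case using tr by (auto simp: Hom_iff)
    qed
  qed
  then show ?thesis
    unfolding bimodule_hom_def left_hom_def 1 total Hom_iff image_subset_iff
    using part_subset_dsum[OF grading_B] by auto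
qed

text \<open>For \<open>x\<close> of degree \<open>h\<close>, the component of \<open>a\<close> in
  degree \<open>d\<close> contributes to degree \<open>h + d\<close> of \<open>N\<close> only.
  Distinct components thus cannot cancel, and \<open>rmul\<close> alters each contribution by a
  sign.\<close>

lemma hcomp_trace_mult:
  assumes tr: "tr \<in> Hom 0" and x: "x \<in> A h"
  shows "hcomp (gr N) (h + d) (tr (x * a)) = tr (x * hcomp A d a)" (is ?mult)
    and "hcomp (gr N) (h + d) (tr (rmul A a x)) = neg_pow (snd d * snd h) (tr (x * hcomp A d a))"
      (is ?rmul)
proof -
  note trN = Hom_dsum[OF tr]
  note add = Hom_add[OF tr] hcomp_add[OF grading_N trN trN] hcomp_add[OF grading_A dsum_A dsum_A]
    distrib_left rmul_add neg_pow_add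
  note zero = Hom_zero[OF tr] hcomp_zero grading_N grading_A
  have "tr (x * a) \<in> gr N (h + e)" if "a \<in> A e" for a e
    using Hom_degree[OF tr mult_A[OF x that]] by simp
  note deg = this
  show ?mult
  proof (induction a rule: A_induct)
    case (part e a)
    show ?case
      unfolding hcomp_part[OF grading_N deg[OF part]] hcomp_part[OF grading_A part]
      by (auto simp: zero)
  qed (simp_all add: add zero)
  show ?rmul
  proof (induction a rule: A_induct)
    case (part e a)
    show ?case
      unfolding rmul_part[OF part x] Hom_neg_pow[OF tr] hcomp_part[OF grading_A part]
        hcomp_part[OF grading_N grading_neg_pow[OF grading_N deg[OF part]]]
      by (auto simp: zero)
  qed (simp_all add: add zero)
qed

lemma trace_mult_zero_iff:
  assumes tr: "tr \<in> Hom 0"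
  shows "(\<forall>x. tr (x * a) = 0) \<longleftrightarrow> (\<forall>x. tr (rmul A a x) = 0)"
proof -
  have zero: "y = 0" if "y \<in> dsum (gr N)" "\<And>d. hcomp (gr N) d y = 0" for y
    using decomposes_hcomp[OF grading_N that(1)] that(2) by (simp add: decomposes_def)
  note trN = Hom_dsum[OF tr]
  have part_iff: "tr (x * a) = 0 \<longleftrightarrow> tr (rmul A a x) = 0" if x: "x \<in> A h" for x h
  proof -
    \<comment> \<open>Every degree has the form \<open>h + d\<close>, the form in which
      \<open>hcomp_trace_mult\<close> gives the components; those of the two traces vanish
      together.\<close>
    have "y = 0 \<longleftrightarrow> (\<forall>d. hcomp (gr N) (h + d) y = 0)" if y: "y \<in> dsum (gr N)" for y
    proof
      assume *: "\<forall>d. hcomp (gr N) (h + d) y = 0"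
      have "hcomp (gr N) d y = 0" for d using *[rule_format, of "d - h"] by simp
      then show "y = 0" by (rule zero[OF y])
    qed (simp add: hcomp_zero[OF grading_N])
    from this[OF trN, of "x * a"] this[OF trN, of "rmul A a x"] show ?thesis
      unfolding hcomp_trace_mult[OF tr x] by simp
  qed
  have "(\<forall>x. f x = 0) \<longleftrightarrow> (\<forall>h. \<forall>x\<in>A h. f x = 0)"
    if "\<And>x y. f (x + y) = f x + f y" for f :: "'a \<Rightarrow> 'a"
  proof -
    have "f 0 = 0" using that[of 0 0] by simp
    then have "f x = 0" if "\<forall>h. \<forall>x\<in>A h. f x = 0" for x
      by (induction x rule: A_induct) (use that \<open>\<And>x y. f (x + y) = f x + f y\<close> in auto)
    then show ?thesis by blast
  qed
  note homogeneous = this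
  show ?thesis
    using part_iff homogeneous[of "\<lambda>x. tr (x * a)"] homogeneous[of "\<lambda>x. tr (rmul A a x)"]
    by (auto simp: Hom_add[OF tr] rmul_add distrib_right)
qed

text \<open>As \<open>tr\<close> has parity 0, the sign of the left action reduces to the one in
  \<open>rmul\<close>.\<close>

lemma lact_H_trace:
  assumes tr: "tr \<in> Hom 0"
  shows "lact H a tr = tr \<circ> rmul A (\<alpha> a)"
proof
  fix x
  have *: "lact H a tr x = tr (rmul A (\<alpha> a) x)" if a: "a \<in> A d" for a d
  proof (induction x rule: A_induct)
    case (part h x)
    show ?case
      by (simp add: lact_H_part[OF a tr part] rmul_part[OF \<alpha>_part[OF a] part] Hom_neg_pow[OF tr])
  qed (simp_all add: lact_H_zero lact_H_add_right rmul_add Hom_add[OF tr] Hom_zero[OF tr])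
  show "lact H a tr x = (tr \<circ> rmul A (\<alpha> a)) x"
    by (induction a rule: A_induct)
      (simp_all add: * lact_H_zero lact_H_add_left \<alpha>_add \<alpha>_zero rmul_add Hom_add[OF tr]
        Hom_zero[OF tr])
qed

text \<open>For \<open>\<beta> r * x\<close> of degree \<open>e + h\<close> the sign of
  \<open>rmul\<close> splits into the one for \<open>x\<close> and the factor
  \<open>snd d * snd e\<close> demanded of a map of degree \<open>d\<close>.\<close>

lemma trace_comp_rmul_Hom:
  assumes tr: "tr \<in> Hom 0" and a: "a \<in> A d"
  shows "tr \<circ> rmul A a \<in> Hom d"
  unfolding Hom_iff
proof (intro conjI allI ballI)
  show "(tr \<circ> rmul A a) (x + y) = (tr \<circ> rmul A a) x + (tr \<circ> rmul A a) y" for x y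
    by (simp add: rmul_add Hom_add[OF tr])
  show "(tr \<circ> rmul A a) x \<in> gr N (e + d)" if "x \<in> A e" for x e
    using Hom_degree[OF tr mult_A[OF that a]]
    by (simp add: rmul_part[OF a that] Hom_neg_pow[OF tr] grading_neg_pow[OF grading_N])
  fix e r x assume r: "r \<in> B e"
  show "(tr \<circ> rmul A a) (\<beta> r * x) = neg_pow (snd d * snd e) (lact N r ((tr \<circ> rmul A a) x))"
  proof (induction x rule: A_induct)
    case (part h x)
    have "\<beta> r * x \<in> A (e + h)" by (intro mult_A part B_subset \<beta>_part r)
    moreover have "tr (\<beta> r * (x * a)) = lact N r (tr (x * a))"
      using tr r by (simp add: Hom_iff)
    ultimately show ?case
      by (simp add: rmul_part[OF a] rmul_part[OF a part] Hom_neg_pow[OF tr] mult.assoc lact_N[OF r]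
          neg_pow_mult algebra_simps)
  qed (simp_all add: lact_N[OF r] distrib_left rmul_add Hom_add[OF tr] Hom_zero[OF tr] neg_pow_add)
qed

lemma trace_comp_rmul_bimodule_hom:
  assumes tr: "tr \<in> Hom 0" and right: "\<And>s x. s \<in> dsum B \<Longrightarrow> tr (x * \<alpha> s) = tr x * s"
  shows "bimodule_hom A B (regular_bimodule A) H (\<lambda>a. tr \<circ> rmul A (\<alpha> a))" 
    (is "bimodule_hom _ _ _ _ ?\<Phi>")
proof -
  have deg: "?\<Phi> a \<in> Hom d" if "a \<in> A d" for a d
    by (rule trace_comp_rmul_Hom[OF tr \<alpha>_part[OF that]])
  have \<Phi>_add: "?\<Phi> (a + b) = ?\<Phi> a + ?\<Phi> b" for a b
    by (simp add: fun_eq_iff \<alpha>_add rmul_add Hom_add[OF tr])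
  have \<Phi>_zero: "?\<Phi> 0 = 0"
    by (simp add: fun_eq_iff \<alpha>_zero Hom_zero[OF tr])
  \<comment> \<open>For inhomogeneous \<open>a\<close> the map need not have a degree; membership in
    \<open>dsum Hom\<close> is what \<open>lact_H_add_fun\<close> asks for.\<close>
  have \<Phi>_dsum: "?\<Phi> a \<in> dsum Hom" for a
    by (induction a rule: A_induct)
      (auto simp only: \<Phi>_add \<Phi>_zero intro: dsum_zero dsum_add grading_Hom part_subset_dsum[OF grading_Hom deg])
  have \<Phi>_arg: "?\<Phi> a (x + y) = ?\<Phi> a x + ?\<Phi> a y" "?\<Phi> a 0 = 0" for a x y
    by (simp_all add: rmul_add Hom_add[OF tr] Hom_zero[OF tr])
  have left: "?\<Phi> (b * a) = lact H b (?\<Phi> a)" for a b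
  proof
    fix x
    \<comment> \<open>The variables are freed one at a time: \<open>*\<close> allows any
      \<open>x\<close>, \<open>**\<close> also any \<open>a\<close>, and the last induction any
      \<open>b\<close>.\<close>
    have *: "?\<Phi> (b * a) x = lact H b (?\<Phi> a) x" if a: "a \<in> A d" and b: "b \<in> A e" for a b d e
    proof (induction x rule: A_induct)
      case (part h x)
      have "?\<Phi> (b * a) x = neg_pow ((snd e + snd d) * snd h) (tr (x * \<alpha> b * \<alpha> a))"
        using rmul_part[OF \<alpha>_part[OF mult_A[OF b a]] part]
        by (simp add: Hom_neg_pow[OF tr] \<alpha>_mult mult.assoc)
      moreover have "?\<Phi> a (x * \<alpha> b) = neg_pow (snd d * (snd h + snd e)) (tr (x * \<alpha> b * \<alpha> a))"
        using rmul_part[OF \<alpha>_part[OF a] mult_A[OF part \<alpha>_part[OF b]]]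
        by (simp add: Hom_neg_pow[OF tr])
      \<comment> \<open>Moving \<open>b\<close> past the map and past the longer argument produces
        \<open>snd d * snd e\<close> twice, which is 0 in \<open>bit\<close>.\<close>
      moreover have "snd e * snd d + snd e * snd h + snd d * (snd h + snd e) = (snd e + snd d) * snd h"
        by (cases "snd d"; cases "snd e"; cases "snd h") simp_all
      ultimately show ?case unfolding lact_H_part[OF b deg[OF a] part] by simp
    qed (simp_all only: \<Phi>_arg lact_H_zero lact_H_add_right)
    have **: "?\<Phi> (b * a) x = lact H b (?\<Phi> a) x" if b: "b \<in> A e" for a b e
    proof (induction a rule: A_induct)
      case (add a a')
      then have "?\<Phi> (b * (a + a')) x = lact H b (?\<Phi> a + ?\<Phi> a') x"
        by (simp only: distrib_left \<Phi>_add plus_fun_apply lact_H_add_fun[OF \<Phi>_dsum \<Phi>_dsum])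
      then show ?case by (simp only: \<Phi>_add)
    next
      case zero
      show ?case unfolding mult_zero_right \<Phi>_zero lact_H_zero by (rule zero_fun_apply)
    qed (rule *[OF _ b])
    show "?\<Phi> (b * a) x = lact H b (?\<Phi> a) x"
      by (induction b rule: A_induct)
        (simp_all only: ** mult_zero_left \<Phi>_zero lact_H_zero zero_fun_apply
          distrib_right \<Phi>_add lact_H_add_left plus_fun_apply)
  qed
  have "?\<Phi> (a * s) = ract H (?\<Phi> a) s" if s: "s \<in> dsum B" for a s
  proof
    fix x
    have *: "?\<Phi> (a * s) x = ract H (?\<Phi> a) s x" if a: "a \<in> A d" and s: "s \<in> B e" for a s d e
    proof (induction x rule: A_induct)
      case (part h x)
      have sA: "s \<in> A e" by (rule B_subset[OF s])
      have "?\<Phi> (a * s) x = neg_pow ((snd d + snd e) * snd h) (tr (x * \<alpha> a * \<alpha> s))"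
        using rmul_part[OF \<alpha>_part[OF mult_A[OF a sA]] part]
        by (simp add: Hom_neg_pow[OF tr] \<alpha>_mult mult.assoc)
      moreover have "?\<Phi> a x = neg_pow (snd d * snd h) (tr (x * \<alpha> a))"
        using rmul_part[OF \<alpha>_part[OF a] part] by (simp add: Hom_neg_pow[OF tr])
      ultimately show ?case
        \<comment> \<open>The assumption \<open>right\<close> takes \<open>s\<close> out of the
          trace, and the sign exponents add up.\<close>
        unfolding ract_H_part[where f = "?\<Phi> a", OF s part \<Phi>_arg(2)]
        by (simp add: neg_pow_mult right[OF part_subset_dsum[OF grading_B s]] distrib_right add.commute)
    qed (simp_all only: \<Phi>_arg ract_H_zero ract_H_add_arg)
    have **: "?\<Phi> (a * s) x = ract H (?\<Phi> a) s x" if s: "s \<in> B e" for a s e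
    proof (induction a rule: A_induct)
      case (add a a')
      then have "?\<Phi> ((a + a') * s) x = ract H (?\<Phi> a + ?\<Phi> a') s x"
        by (simp only: distrib_right \<Phi>_add plus_fun_apply ract_H_add_fun)
      then show ?case by (simp only: \<Phi>_add)
    next
      case zero
      show ?case unfolding mult_zero_left \<Phi>_zero ract_H_zero by (rule zero_fun_apply)
    qed (rule *[OF _ s])
    \<comment> \<open>The right action splits \<open>s\<close> into components with respect to
      \<open>B\<close>, so the induction runs over the parts of \<open>B\<close>.\<close>
    from grading_B s show "?\<Phi> (a * s) x = ract H (?\<Phi> a) s x"
      by (induction s rule: dsum_induct)
        (simp_all only: ** mult_zero_right \<Phi>_zero ract_H_zero zero_fun_apply
          distrib_left \<Phi>_add ract_H_add_right plus_fun_apply)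
  qed
  then show ?thesis
    using \<Phi>_add left deg
    by (simp add: bimodule_hom_def left_hom_def gr_H image_subset_iff regular_bimodule_simps total)
qed

text \<open>\<open>HOM_part\<close> reads only the grading and the left action, which both twists
  share.\<close>

lemma HOM_part_ltwist: "HOM_part B (ltwist \<beta> A) N = Hom"
  by (simp add: fun_eq_iff HOM_part_def ltwist_def twist_def)

section \<open>Isomorphisms versus trace maps\<close>

lemma isomorphic_iff_trace:
  "bimodule_isomorphic A B (regular_bimodule A) H \<longleftrightarrow>
    (\<exists>tr. bimodule_hom B B (twist \<beta> \<alpha> A) N tr \<and>
       (\<forall>a. (\<forall>x. tr (x * a) = 0) \<longrightarrow> a = 0) \<and>
       (\<forall>\<phi>\<in>dsum Hom. \<exists>a. \<phi> = tr \<circ> rmul A a))"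
proof
  assume "bimodule_isomorphic A B (regular_bimodule A) H"
  then obtain \<Phi> where hom: "bimodule_hom A B (regular_bimodule A) H \<Phi>"
    and bij: "bij_betw \<Phi> UNIV (dsum Hom)"
    unfolding bimodule_isomorphic_def by (auto simp: regular_bimodule_simps total gr_H)
  have left: "\<Phi> (a * b) = lact H a (\<Phi> b)" and deg: "b \<in> A d \<Longrightarrow> \<Phi> b \<in> Hom d"
    and add: "\<Phi> (a + b) = \<Phi> a + \<Phi> b" for a b d
    using hom unfolding bimodule_hom_def left_hom_def regular_bimodule_simps total gr_H by blast+
  have right: "\<Phi> (a * s) = ract H (\<Phi> a) s" if "s \<in> dsum B" for a s
    using hom that by (auto simp: bimodule_hom_def regular_bimodule_simps total)
  define tr where "tr = \<Phi> 1"
  have tr: "tr \<in> Hom 0" using A deg by (simp add: tr_def graded_superring_def)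
  have \<Phi>: "\<Phi> a = tr \<circ> rmul A (\<alpha> a)" for a
    using left[of a 1] by (simp add: lact_H_trace[OF tr] flip: tr_def)
  have part: "tr (x * \<alpha> s) = tr x * s" if s: "s \<in> B d" for s x d
  proof (induction x rule: A_induct)
    case (part h x)
    \<comment> \<open>Both sides are \<open>\<Phi> s x\<close>, from \<open>s = 1 * s\<close> and
      \<open>s = s * 1\<close>. At homogeneous \<open>x\<close> they carry the same sign, since
      \<open>tr\<close> has parity 0; cancelling it leaves right linearity.\<close>
    have "ract H tr s x = lact H s tr x"
      using right[OF part_subset_dsum[OF grading_B s], of 1] left[of s 1] by (simp add: tr_def)
    then show ?case
      by (simp add: ract_H_part[OF s part] lact_H_part[OF B_subset[OF s] tr part] Hom_zero[OF tr]
          neg_pow_cancel)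
  qed (simp_all add: Hom_zero[OF tr] Hom_add[OF tr] distrib_right)
  have "tr (x * \<alpha> s) = tr x * s" if "s \<in> dsum B" for s x
    using grading_B that
    by (induction s rule: dsum_induct)
      (simp_all add: part \<alpha>_zero \<alpha>_add Hom_zero[OF tr] Hom_add[OF tr] distrib_left)
  then have "bimodule_hom B B (twist \<beta> \<alpha> A) N tr" using tr by (simp add: bimodule_hom_iff)
  moreover have "a = 0" if "\<forall>x. tr (x * a) = 0" for a
  proof -
    \<comment> \<open>\<open>\<Phi> b\<close> involves \<open>\<alpha> b\<close>, so
      \<open>a\<close> is first written in that form.\<close>
    obtain b where b: "a = \<alpha> b" using bij_is_surj[OF \<alpha>_bij] by (metis surjD)
    have "\<Phi> b = 0"
      using that by (simp add: trace_mult_zero_iff[OF tr] b \<Phi> fun_eq_iff)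
    moreover have "\<Phi> 0 = 0" using add[of 0 0] by simp
    ultimately have "b = 0" using bij by (metis UNIV_I bij_betw_def inj_onD)
    then show ?thesis by (simp add: b \<alpha>_zero)
  qed
  moreover have "\<exists>a. \<phi> = tr \<circ> rmul A a" if "\<phi> \<in> dsum Hom" for \<phi>
    using bij that \<Phi> by (metis bij_betw_def imageE)
  ultimately show "\<exists>tr. bimodule_hom B B (twist \<beta> \<alpha> A) N tr \<and>
       (\<forall>a. (\<forall>x. tr (x * a) = 0) \<longrightarrow> a = 0) \<and> (\<forall>\<phi>\<in>dsum Hom. \<exists>a. \<phi> = tr \<circ> rmul A a)"
    by blast
next
  assume "\<exists>tr. bimodule_hom B B (twist \<beta> \<alpha> A) N tr \<and>
       (\<forall>a. (\<forall>x. tr (x * a) = 0) \<longrightarrow> a = 0) \<and> (\<forall>\<phi>\<in>dsum Hom. \<exists>a. \<phi> = tr \<circ> rmul A a)"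
  then obtain tr where tr: "tr \<in> Hom 0" and right: "\<And>s x. s \<in> dsum B \<Longrightarrow> tr (x * \<alpha> s) = tr x * s"
    and L3: "\<And>a. (\<forall>x. tr (x * a) = 0) \<Longrightarrow> a = 0"
    and L4: "\<And>\<phi>. \<phi> \<in> dsum Hom \<Longrightarrow> \<exists>a. \<phi> = tr \<circ> rmul A a"
    by (auto simp: bimodule_hom_iff)
  let ?\<Phi> = "\<lambda>a. tr \<circ> rmul A (\<alpha> a)"
  have hom: "bimodule_hom A B (regular_bimodule A) H ?\<Phi>"
    by (rule trace_comp_rmul_bimodule_hom[OF tr right])
  have "inj ?\<Phi>"
  proof (rule injI)
    fix a b assume eq: "?\<Phi> a = ?\<Phi> b"
    have "tr (rmul A (\<alpha> (a - b)) x) = 0" for x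
    proof -
      \<comment> \<open>Additivity at \<open>a = (a - b) + b\<close> reduces injectivity to a
        trivial kernel, the unsigned form of which is \<open>L3\<close>.\<close>
      have "tr (rmul A (\<alpha> (a - b)) x) + tr (rmul A (\<alpha> b) x) = tr (rmul A (\<alpha> (a - b + b)) x)"
        by (simp only: \<alpha>_add rmul_add Hom_add[OF tr])
      then show ?thesis using fun_cong[OF eq, of x] by simp
    qed
    then have "\<alpha> (a - b) = 0"
      by (intro L3) (simp add: trace_mult_zero_iff[OF tr])
    then have "\<alpha> (a - b) = \<alpha> 0" by (simp only: \<alpha>_zero)
    then show "a = b" using bij_is_inj[OF \<alpha>_bij] by (simp add: inj_eq)
  qed
  moreover have "range ?\<Phi> = dsum Hom"
  proof
    have "left_hom A (regular_bimodule A) H ?\<Phi>" using hom by (simp add: bimodule_hom_def)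
    then have "?\<Phi> a \<in> dsum (gr H)" for a
      by (rule left_hom_dsum[rotated 2])
        (simp_all add: regular_bimodule_simps gr_H grading_A grading_Hom)
    then show "range ?\<Phi> \<subseteq> dsum Hom" by (auto simp: gr_H)
    show "dsum Hom \<subseteq> range ?\<Phi>"
    proof
      fix \<phi> assume "\<phi> \<in> dsum Hom"
      then obtain a where "\<phi> = tr \<circ> rmul A a" using L4 by blast
      moreover obtain b where "a = \<alpha> b" using bij_is_surj[OF \<alpha>_bij] by (metis surjD)
      ultimately show "\<phi> \<in> range ?\<Phi>" by blast
    qed
  qed
  ultimately have "bij_betw ?\<Phi> UNIV (dsum Hom)" by (simp add: bij_betw_def)
  then show "bimodule_isomorphic A B (regular_bimodule A) H"
    using hom by (auto simp: bimodule_isomorphic_def regular_bimodule_simps total gr_H)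
qed

end

theorem corollary4p2:
  fixes A B :: "('l::ab_group_add, 'a::{ring, monoid_mult}) ring_grading"
    and \<alpha> \<beta> :: "'a \<Rightarrow> 'a" and lam :: 'l and \<pi> :: bit
  assumes "graded_superring A" and "dsum A = UNIV"
    and "graded_subring B A"
    and "graded_automorphism A \<alpha>" and "graded_automorphism B \<beta>"
    and "finitely_generated B (regular_bimodule A)" and "projective B (regular_bimodule A)"
  shows "frobenius_extension A B \<alpha> \<beta> (- lam, \<pi>) \<longleftrightarrow>
    (\<exists>tr. bimodule_hom B B (twist \<beta> \<alpha> A) (shift B lam \<pi> (regular_bimodule B)) tr \<and>
       (\<forall>a. (\<forall>x. tr (x * a) = 0) \<longrightarrow> a = 0) \<and>
       (\<forall>\<phi>\<in>dsum (HOM_part B (ltwist \<beta> A) (shift B lam \<pi> (regular_bimodule B))).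
          \<exists>a. \<phi> = tr \<circ> rmul A a))"
proof -
  interpret graded_extension A B \<alpha> \<beta> lam \<pi>
    using assms(1-5) by unfold_locales
  show ?thesis
    \<comment> \<open>The definition shifts by the negative of the first degree coordinate, and
      \<open>- (- lam) = lam\<close>.\<close>
    using assms(6,7) by (simp add: frobenius_extension_def isomorphic_iff_trace HOM_part_ltwist)
qed

end
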